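(* Let $j,n$ be integers with $2\le j\le n-1$. Assume that $\mathbb{E}|X_{j-1:n-2}|<\infty$ and that the parent distribution is supported on some (possibly unbounded) interval $(a,b)$ with density $f>0$ on $(a,b)$. If $$\mathbb{E}(X_{j-1:n-2}\mid X_{j:n})=X_{j:n}\quad\text{almost surely},$$ then the parent distribution has the quantile density $q$ of the form $$q(u)\propto\frac{j-1+(n-2j+1)u}{u^{1+(j-1)\lambda}\,(1-u)^{1+(n-j)(1-\lambda)}},\qquad u\in(0,1),$$ where $\lambda=\dfrac{j(j-1)}{(n-j+1)(n-j)+j(j-1)}$.
   Context: $X_1,X_2,\ldots$ are independent identically distributed real random variables with cumulative distribution function $F$ (the parent distribution), absolutely continuous with respect to Lebesgue measure with density $f$. $X_{i:m}$ denotes the $i$-th smallest among $X_1,\ldots,X_m$; in particular the sample of size $n-2$ consists of the first $n-2$ elements of the sample of size $n$. If $f$ is strictly positive on an interval $(a,b)$ carrying the distribution, then $F$ is invertible on $(a,b)$; its inverse $Q:(0,1)\to(a,b)$ is the quantile function, which satisfies $Q(y)=\int_{y_0}^{y}q(u)\,du$ (up to an additive constant); $q=Q'$ is called the quantile density. Equivalently, $f=T(F)$ on $(a,b)$ if and only if $q=1/T$ on $(0,1)$. The symbol $\propto$ means equality up to a positive multiplicative constant. *)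

theory Defs
  imports "HOL-Probability.Probability"
begin

text \<open>\<open>order_stat X i m\<close> is the \<open>i\<close>-th smallest of \<open>X 1, \<dots>, X m\<close>. Samples and ranks are both
  counted from 1, so it is meaningful for \<open>1 \<le> i \<le> m\<close>.\<close>
definition order_stat :: "(nat \<Rightarrow> 'a \<Rightarrow> real) \<Rightarrow> nat \<Rightarrow> nat \<Rightarrow> 'a \<Rightarrow> real" where
  "order_stat X i m \<omega> = sort (map (\<lambda>k. X k \<omega>) [1..<Suc m]) ! (i - 1)"

text \<open>Conditional expectation given a real random variable \<open>Z\<close>, i.e. given the
  \<open>\<sigma>\<close>-algebra generated by \<open>Z\<close>.\<close>
definition cond_exp_given :: "'a measure \<Rightarrow> ('a \<Rightarrow> real) \<Rightarrow> ('a \<Rightarrow> real) \<Rightarrow> 'a \<Rightarrow> real" where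
  "cond_exp_given M Y Z = real_cond_exp M (vimage_algebra (space M) Z borel) Y"

text \<open>The inverse of a distribution function \<open>F\<close> that maps the interval \<open>(a, b)\<close>
  bijectively onto \<open>(0, 1)\<close>; only its values on \<open>(0, 1)\<close> are meaningful.\<close>
definition quantile_fun :: "ereal \<Rightarrow> ereal \<Rightarrow> (real \<Rightarrow> real) \<Rightarrow> real \<Rightarrow> real" where
  "quantile_fun a b F = the_inv_into (einterval a b) F"

text \<open>\<open>q = Q'\<close> on \<open>(0, 1)\<close>, and \<open>Q\<close> is an indefinite integral of \<open>q\<close>. The derivative is
  required at every point of \<open>(0, 1)\<close>, not merely almost everywhere.\<close>
definition has_quantile_density ::
    "ereal \<Rightarrow> ereal \<Rightarrow> (real \<Rightarrow> real) \<Rightarrow> (real \<Rightarrow> real) \<Rightarrow> bool" where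
  "has_quantile_density a b F q \<longleftrightarrow>
     (\<forall>u\<in>{0<..<1}. (quantile_fun a b F has_real_derivative q u) (at u)) \<and>
     (\<forall>y\<^sub>0\<in>{0<..<1}. \<forall>y\<in>{0<..<1}.
        interval_lebesgue_integrable lborel (ereal y\<^sub>0) (ereal y) q \<and>
        quantile_fun a b F y - quantile_fun a b F y\<^sub>0 = (LBINT u=ereal y\<^sub>0..ereal y. q u))"

end

theory Submission
  imports Defs
begin

text \<open>
  Write \<open>Y = X\<^bsub>j-1:n-2\<^esub>\<close>, \<open>Z = X\<^bsub>j:n\<^esub>\<close>, \<open>m = j - 1\<close>, \<open>k = n - j\<close>. The hypothesis gives
  \<open>E (Y - Z) 1{Z \<le> t} = 0\<close> for every \<open>t\<close>, and writing \<open>Y - Z\<close> as the integral over \<open>y\<close> of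
  \<open>1{Z \<le> y} - 1{Y \<le> y}\<close> turns this expectation into the integral of a polynomial in \<open>F y\<close> and \<open>F t\<close>.
  In terms of \<open>P t\<close>, the integral of \<open>F\<^sup>m\<close> up to \<open>t\<close>, and \<open>S t\<close>, the integral of \<open>(1 - F)\<^sup>k\<close>
  from \<open>t\<close> on, the increments in \<open>t\<close> at a fixed value of \<open>F\<close> cancel to first order, so dividing
  by increments of \<open>F\<close> (no differentiability of \<open>F\<close> is available yet) leaves
  \<open>(1 - F)\<^sup>k P = \<kappa> F\<^sup>m S\<close> with \<open>\<kappa> = j (j - 1) / ((n - j + 1) (n - j))\<close>. As \<open>P\<close> and \<open>S\<close> are
  continuously differentiable, this relation forces \<open>F\<close> to be differentiable, and its logarithmic
  derivative is a first-order equation whose solution is the stated family.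
\<close>

section \<open>Order statistics and counting\<close>

text \<open>In a sorted list the entries at most \<open>y\<close> form an initial segment; position
  \<open>i\<close>, counted from 0, lies in it exactly when it has more than \<open>i\<close>
  entries.\<close>

lemma sorted_nth_le_iff:
  assumes "sorted xs" "i < length xs"
  shows "xs ! i \<le> y \<longleftrightarrow> i < length (filter (\<lambda>x. x \<le> y) xs)"
  using assms
proof (induction xs arbitrary: i)
  case (Cons x xs)
  show ?case
  proof (cases "x \<le> y")
    case True
    then show ?thesis using Cons by (cases i) auto
  next
    case False
    then have "z > y" if "z \<in> set (x # xs)" for z
      using that Cons.prems(1) by auto
    then have "filter (\<lambda>x. x \<le> y) (x # xs) = []" "(x # xs) ! i > y"
      using Cons.prems(2) nth_mem[of i "x # xs"] by (simp_all add: filter_empty_conv not_le)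
    then show ?thesis by simp
  qed
qed simp

text \<open>The index set is kept rather than its size: independence gives the probability of each
  particular set, and the smaller sample is recovered by intersecting with its own indices.\<close>

definition below :: "(nat \<Rightarrow> 'a \<Rightarrow> real) \<Rightarrow> nat \<Rightarrow> real \<Rightarrow> 'a \<Rightarrow> nat set" where
  "below X n y \<omega> = {k \<in> {1..n}. X k \<omega> \<le> y}"

lemma finite_below [simp]: "finite (below X n y \<omega>)"
  by (simp add: below_def)

lemma below_mono: "y \<le> z \<Longrightarrow> below X n y \<omega> \<subseteq> below X n z \<omega>"
  by (auto simp: below_def)

lemma order_stat_le_iff:
  assumes "1 \<le> i" "i \<le> m"
  shows "order_stat X i m \<omega> \<le> y \<longleftrightarrow> i \<le> card (below X m y \<omega>)"
proof -
  let ?xs = "map (\<lambda>k. X k \<omega>) [1..<Suc m]"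
  have "length (filter (\<lambda>x. x \<le> y) (sort ?xs)) = length (filter (\<lambda>k. X k \<omega> \<le> y) [1..<Suc m])"
    by (simp only: filter_sort length_sort filter_map length_map comp_def)
  also have "\<dots> = card (set (filter (\<lambda>k. X k \<omega> \<le> y) [1..<Suc m]))"
    by (rule distinct_card[symmetric]) simp
  also have "set (filter (\<lambda>k. X k \<omega> \<le> y) [1..<Suc m]) = below X m y \<omega>"
    by (auto simp: below_def)
  finally have "length (filter (\<lambda>x. x \<le> y) (sort ?xs)) = card (below X m y \<omega>)" .
  moreover have "i - 1 < length (sort ?xs)"
    using assms by (simp del: upt_Suc)
  ultimately have "order_stat X i m \<omega> \<le> y \<longleftrightarrow> i - 1 < card (below X m y \<omega>)"
    unfolding order_stat_def by (metis sorted_nth_le_iff sorted_sort)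
  then show ?thesis using assms(1) by linarith
qed

lemma measurable_card_below:
  assumes "\<And>k. k \<in> {1..n} \<Longrightarrow> X k \<in> borel_measurable M"
  shows "(\<lambda>\<omega>. card (below X n y \<omega>)) \<in> measurable M (count_space UNIV)"
proof (rule measurable_card)
  show "{\<omega> \<in> space M. k \<in> below X n y \<omega>} \<in> sets M" for k
  proof (cases "k \<in> {1..n}")
    case True
    have [measurable]: "X k \<in> borel_measurable M" using assms True by blast
    show ?thesis using True by (simp add: below_def)
  next
    case False
    then have "{\<omega> \<in> space M. k \<in> below X n y \<omega>} = {}" by (auto simp: below_def)
    then show ?thesis by (simp only: sets.empty_sets)
  qed
qed

lemma borel_measurable_order_stat:
  assumes "\<And>k. k \<in> {1..m} \<Longrightarrow> X k \<in> borel_measurable M" "1 \<le> i" "i \<le> m"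
  shows "order_stat X i m \<in> borel_measurable M"
proof (unfold borel_measurable_iff_le, rule allI)
  fix y
  have [measurable]: "(\<lambda>\<omega>. card (below X m y \<omega>)) \<in> measurable M (count_space UNIV)"
    using assms by (intro measurable_card_below) auto
  have "{\<omega> \<in> space M. i \<le> card (below X m y \<omega>)} \<in> sets M"
    by measurable
  then show "{\<omega> \<in> space M. order_stat X i m \<omega> \<le> y} \<in> sets M"
    by (simp only: order_stat_le_iff[OF assms(2,3)])
qed

text \<open>Equal sets at the levels \<open>s\<close> and \<open>r\<close> mean that no observation
  falls in \<open>(s, r]\<close>. For a fixed set \<open>A\<close> this is a product event,
  \<open>X i \<le> s\<close> on \<open>A\<close> and \<open>X i > r\<close> off \<open>A\<close>,
  and distinct \<open>A\<close> give disjoint events.\<close>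

lemma prob_below:
  fixes X :: "nat \<Rightarrow> 'a \<Rightarrow> real" and F :: "real \<Rightarrow> real"
  assumes "prob_space M" "prob_space.indep_vars M (\<lambda>_. borel) X {1..n}" "0 < n"
    and F: "\<And>i y. i \<in> {1..n} \<Longrightarrow> measure M {\<omega> \<in> space M. X i \<omega> \<le> y} = F y"
    and "s \<le> r" and As: "\<A> \<subseteq> {A. A \<subseteq> {1..n} \<and> card A = p}"
  shows "{\<omega> \<in> space M. below X n s \<omega> = below X n r \<omega> \<and> below X n s \<omega> \<in> \<A>} \<in> sets M" (is "?E \<in> _")
    and "measure M {\<omega> \<in> space M. below X n s \<omega> = below X n r \<omega> \<and> below X n s \<omega> \<in> \<A>}
           = card \<A> * (F s ^ p * (1 - F r) ^ (n - p))"
proof -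
  interpret prob_space M by fact
  define B where "B A i = (if i \<in> A then {..s} else {r<..})" for A and i :: nat
  define E where "E A = (\<Inter>i\<in>{1..n}. X i -` B A i \<inter> space M)" for A
  have X [measurable]: "X i \<in> borel_measurable M" if "i \<in> {1..n}" for i
    using assms(2) that by (auto simp: indep_vars_def)
  have EA: "E A = {\<omega> \<in> space M. below X n s \<omega> = A \<and> below X n r \<omega> = A}" if "A \<subseteq> {1..n}" for A
  proof (intro set_eqI)
    fix \<omega>
    have "\<omega> \<in> E A \<longleftrightarrow> \<omega> \<in> space M \<and> (\<forall>i\<in>{1..n}. if i \<in> A then X i \<omega> \<le> s else X i \<omega> > r)"
      using \<open>0 < n\<close> by (auto simp: E_def B_def)
    moreover have "(if i \<in> A then X i \<omega> \<le> s else X i \<omega> > r) \<longleftrightarrow>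
        (X i \<omega> \<le> s \<longleftrightarrow> i \<in> A) \<and> (X i \<omega> \<le> r \<longleftrightarrow> i \<in> A)" for i
      using \<open>s \<le> r\<close> by (cases "i \<in> A") auto
    moreover have "(\<forall>i\<in>{1..n}. X i \<omega> \<le> z \<longleftrightarrow> i \<in> A) \<longleftrightarrow> below X n z \<omega> = A" for z
      using that unfolding below_def by blast
    ultimately show "\<omega> \<in> E A \<longleftrightarrow> \<omega> \<in> {\<omega> \<in> space M. below X n s \<omega> = A \<and> below X n r \<omega> = A}"
      by (simp add: ball_conj_distrib)
  qed
  have E_sets: "E A \<in> events" for A
    unfolding E_def
  proof (rule sets.finite_INT)
    show "X i -` B A i \<inter> space M \<in> events" if "i \<in> {1..n}" for i
      by (rule measurable_sets[OF X[OF that]]) (simp add: B_def)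
  qed (use \<open>0 < n\<close> in auto)
  have P: "prob (E A) = F s ^ p * (1 - F r) ^ (n - p)" if "A \<in> \<A>" for A
  proof -
    have A: "A \<subseteq> {1..n}" "card A = p" using As that by auto
    have "prob (E A) = (\<Prod>i\<in>{1..n}. prob (X i -` B A i \<inter> space M))"
      unfolding E_def using \<open>0 < n\<close> by (intro indep_varsD[OF assms(2)]) (auto simp: B_def)
    also have "\<dots> = (\<Prod>i\<in>{1..n}. if i \<in> A then F s else 1 - F r)"
    proof (rule prod.cong)
      fix i assume i: "i \<in> {1..n}"
      have "X i -` {..s} \<inter> space M = {\<omega> \<in> space M. X i \<omega> \<le> s}" by auto
      moreover have "X i -` {r<..} \<inter> space M = space M - {\<omega> \<in> space M. X i \<omega> \<le> r}" by auto
      moreover have "{\<omega> \<in> space M. X i \<omega> \<le> r} \<in> events" using X[OF i] by measurable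
      ultimately show "prob (X i -` B A i \<inter> space M) = (if i \<in> A then F s else 1 - F r)"
        using F[OF i] prob_compl by (auto simp: B_def)
    qed simp
    also have "\<dots> = F s ^ p * (1 - F r) ^ (n - p)"
    proof -
      have "{1..n} \<inter> {i. i \<in> A} = A" "{1..n} \<inter> - {i. i \<in> A} = {1..n} - A" using A by auto
      moreover have "card ({1..n} - A) = n - p"
        using A by (simp add: card_Diff_subset finite_subset)
      ultimately show ?thesis by (simp add: prod.If_cases A)
    qed
    finally show ?thesis .
  qed
  have fin: "finite \<A>" using As finite_subset[of \<A> "Pow {1..n}"] by auto
  have EA': "E A = {\<omega> \<in> space M. below X n s \<omega> = A \<and> below X n r \<omega> = A}" if "A \<in> \<A>" for A
    using As that by (intro EA) auto
  have UN: "?E = (\<Union>A\<in>\<A>. E A)"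
    by (auto simp: EA')
  show "?E \<in> sets M" unfolding UN using fin E_sets by (rule sets.finite_UN)
  have "disjoint_family_on E \<A>"
    by (auto simp: disjoint_family_on_def EA')
  then have "prob (\<Union>A\<in>\<A>. E A) = (\<Sum>A\<in>\<A>. prob (E A))"
    using fin E_sets by (intro finite_measure_finite_Union) auto
  then show "measure M ?E = card \<A> * (F s ^ p * (1 - F r) ^ (n - p))" unfolding UN by (simp add: P)
qed

section \<open>Layer-cake representation of the expectation of \<open>Y - Z\<close>\<close>

text \<open>The difference of the two steps is the signed indicator of the half-open interval
  between \<open>z\<close> and \<open>w\<close>; of \<open>{z..<w}\<close> and
  \<open>{w..<z}\<close> at least one is empty.\<close>

lemma step_difference_integral:
  fixes z w :: real
  defines "g \<equiv> \<lambda>y. (if z \<le> y then 1 else 0) - (if w \<le> y then 1 else 0 :: real)"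
  shows "integrable lborel g" "(\<integral>y. g y \<partial>lborel) = w - z" "(\<integral>y. \<bar>g y\<bar> \<partial>lborel) = \<bar>w - z\<bar>"
proof -
  have g: "g = (\<lambda>y. indicator {z..<w} y - indicator {w..<z} y)"
    and g': "(\<lambda>y. \<bar>g y\<bar>) = (\<lambda>y. indicator {z..<w} y + indicator {w..<z} y)"
    by (auto simp: g_def indicator_def fun_eq_iff)
  have i: "integrable lborel (indicator {x..<y} :: real \<Rightarrow> real)" for x y :: real
    by (cases "x \<le> y") auto
  have m: "measure lborel {x..<y} = max 0 (y - x)" for x y :: real
    by (cases "x \<le> y") auto
  show "integrable lborel g" unfolding g by (intro Bochner_Integration.integrable_diff i)
  show "(\<integral>y. g y \<partial>lborel) = w - z"
    unfolding g by (subst Bochner_Integration.integral_diff[OF i i]) (simp add: m)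
  show "(\<integral>y. \<bar>g y\<bar> \<partial>lborel) = \<bar>w - z\<bar>"
    unfolding g' by (subst Bochner_Integration.integral_add[OF i i]) (simp add: m)
qed

text \<open>Fubini applies because integrating the absolute value over \<open>y\<close> first gives
  \<open>\<bar>Y - Z\<bar>\<close> on \<open>C\<close>, which is integrable.\<close>

lemma expectation_difference_eq_integral:
  fixes Y Z :: "'a \<Rightarrow> real"
  assumes "prob_space M" and Y: "integrable M Y" and Z: "integrable M Z" and C [measurable]: "C \<in> sets M"
  defines "h \<equiv> \<lambda>\<omega> y. ((if Z \<omega> \<le> y then 1 else 0) - (if Y \<omega> \<le> y then 1 else 0)) * indicator C \<omega> :: real"
  shows "integrable lborel (\<lambda>y. \<integral>\<omega>. h \<omega> y \<partial>M)"
    and "(\<integral>y. (\<integral>\<omega>. h \<omega> y \<partial>M) \<partial>lborel) = (\<integral>\<omega>. (Y \<omega> - Z \<omega>) * indicator C \<omega> \<partial>M)"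
proof -
  interpret prob_space M by fact
  interpret pair_sigma_finite M lborel
    by (intro pair_sigma_finite.intro lborel.sigma_finite_measure_axioms sigma_finite_measure_axioms)
  have [measurable]: "Y \<in> borel_measurable M" "Z \<in> borel_measurable M" using Y Z by auto
  have int: "integrable lborel (h \<omega>)"
    and eq: "(\<integral>y. h \<omega> y \<partial>lborel) = (Y \<omega> - Z \<omega>) * indicator C \<omega>"
    and abs: "(\<integral>y. norm (h \<omega> y) \<partial>lborel) = \<bar>(Y \<omega> - Z \<omega>) * indicator C \<omega>\<bar>" for \<omega>
    unfolding h_def abs_mult real_norm_def
    using step_difference_integral[of "Z \<omega>" "Y \<omega>"] by simp_all
  have "integrable (M \<Otimes>\<^sub>M lborel) (case_prod h)"
  proof (rule Fubini_integrable)
    show "case_prod h \<in> borel_measurable (M \<Otimes>\<^sub>M lborel)"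
      unfolding h_def by measurable
    show "integrable M (\<lambda>\<omega>. \<integral>y. norm (case_prod h (\<omega>, y)) \<partial>lborel)"
      using Y Z by (simp only: prod.case abs)
        (intro integrable_abs integrable_real_mult_indicator Bochner_Integration.integrable_diff C)
    show "AE \<omega> in M. integrable lborel (\<lambda>y. case_prod h (\<omega>, y))"
      using int by simp
  qed
  from integrable_snd[OF this] Fubini_integral[OF this]
  show "integrable lborel (\<lambda>y. \<integral>\<omega>. h \<omega> y \<partial>M)"
    and "(\<integral>y. (\<integral>\<omega>. h \<omega> y \<partial>M) \<partial>lborel) = (\<integral>\<omega>. (Y \<omega> - Z \<omega>) * indicator C \<omega> \<partial>M)"
    by (simp_all add: eq)
qed

text \<open>Deleting the two largest indices is a bijection onto the subsets of
  \<open>{1..N}\<close> with \<open>m - 1\<close> elements.\<close>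

lemma card_supersets_pair:
  assumes "0 < m"
  shows "card {A. A \<subseteq> {1..Suc (Suc N)} \<and> {Suc N, Suc (Suc N)} \<subseteq> A \<and> card A = Suc m} = N choose (m - 1)"
    (is "card ?S = _")
proof -
  let ?T = "{A. A \<subseteq> {1..N} \<and> card A = m - 1}"
  let ?p = "{Suc N, Suc (Suc N)}"
  have "bij_betw (\<lambda>A. A \<union> ?p) ?T ?S"
  proof (rule bij_betw_byWitness[where f' = "\<lambda>A. A - ?p"])
    show "\<forall>A\<in>?T. A \<union> ?p - ?p = A" by fastforce
    show "\<forall>A\<in>?S. A - ?p \<union> ?p = A" by blast
    show "(\<lambda>A. A \<union> ?p) ` ?T \<subseteq> ?S"
    proof safe
      fix A assume A: "A \<subseteq> {1..N}" "card A = m - 1"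
      then have "finite A" "A \<inter> ?p = {}" using finite_subset by fastforce+
      then show "card (A \<union> ?p) = Suc m" using A \<open>0 < m\<close> by (subst card_Un_disjoint) auto
    qed fastforce+
    show "(\<lambda>A. A - ?p) ` ?S \<subseteq> ?T"
    proof
      fix C assume "C \<in> (\<lambda>A. A - ?p) ` ?S"
      then obtain A where A: "A \<subseteq> {1..Suc (Suc N)}" "?p \<subseteq> A" "card A = Suc m" "C = A - ?p" by blast
      then have "card C = m - 1" by (simp add: card_Diff_subset)
      moreover have "C \<subseteq> {1..N}" using A by fastforce
      ultimately show "C \<in> ?T" by simp
    qed
  qed
  then have "card ?S = card ?T" by (rule bij_betw_same_card[symmetric])
  then show ?thesis by (simp add: n_subsets)
qed

text \<open>\<open>A\<close> and \<open>B\<close> stand for the indices of the observations below two levels; the indices \<open>Suc N\<close> and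
  \<open>Suc (Suc N)\<close> belong to the larger sample only.\<close>
lemma removed_pair_cases:
  fixes A B :: "nat set"
  assumes "0 < m" and B: "B \<subseteq> {1..Suc (Suc N)}" and "A \<subseteq> B"
  defines "\<A> \<equiv> {A. A \<subseteq> {1..N} \<and> card A = m}"
    and "\<B> \<equiv> {A. A \<subseteq> {1..Suc (Suc N)} \<and> {Suc N, Suc (Suc N)} \<subseteq> A \<and> card A = Suc m}"
  shows "of_bool (Suc m \<le> card A) - of_bool (m \<le> card (A \<inter> {1..N})) * of_bool (Suc m \<le> card B)
           = (of_bool (A \<in> \<B>) - of_bool (A \<in> \<A>) + of_bool (A = B \<and> A \<in> \<A>) :: real)"
    and "of_bool (Suc m \<le> card A) - of_bool (m \<le> card (B \<inter> {1..N})) * of_bool (Suc m \<le> card A)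
           = (of_bool (A = B \<and> A \<in> \<B>) :: real)"
proof -
  let ?p = "{Suc N, Suc (Suc N)}"
  have fin: "finite A" "finite B" using B \<open>A \<subseteq> B\<close> finite_subset by (meson finite_atLeastAtMost)+
  have split: "card C = card (C \<inter> {1..N}) + card (C \<inter> ?p)" if "C \<subseteq> {1..Suc (Suc N)}" for C
  proof -
    have "C = (C \<inter> {1..N}) \<union> (C \<inter> ?p)" using that by fastforce
    moreover have "(C \<inter> {1..N}) \<inter> (C \<inter> ?p) = {}" by auto
    ultimately show ?thesis
      by (metis card_Un_disjoint finite_Int finite_atLeastAtMost finite.emptyI finite.insertI)
  qed
  have A: "A \<subseteq> {1..Suc (Suc N)}" using B \<open>A \<subseteq> B\<close> by blast
  have p2: "card (C \<inter> ?p) \<le> 2" "card (C \<inter> ?p) = 2 \<longleftrightarrow> ?p \<subseteq> C" "card (C \<inter> ?p) = 0 \<longleftrightarrow> C \<inter> ?p = {}" for C :: "nat set"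
    by (auto simp: Int_insert_right)
  have inA: "C \<in> \<A> \<longleftrightarrow> card (C \<inter> {1..N}) = m \<and> card (C \<inter> ?p) = 0" if "C \<subseteq> {1..Suc (Suc N)}" for C
  proof -
    have "C \<subseteq> {1..N} \<longleftrightarrow> C \<inter> ?p = {}" using that by fastforce
    then show ?thesis unfolding p2 \<A>_def using split[OF that] by (auto simp: Int_absorb2)
  qed
  have inB: "C \<in> \<B> \<longleftrightarrow> card (C \<inter> {1..N}) = m - 1 \<and> card (C \<inter> ?p) = 2" if "C \<subseteq> {1..Suc (Suc N)}" for C
    unfolding p2 \<B>_def using split[OF that] p2(2)[of C] that \<open>0 < m\<close> by auto
  have AB: "card A = card B \<longleftrightarrow> A = B" using card_subset_eq[OF fin(2) \<open>A \<subseteq> B\<close>] by auto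
  have le: "card (A \<inter> {1..N}) \<le> card (B \<inter> {1..N})" "card (A \<inter> ?p) \<le> card (B \<inter> ?p)"
    using \<open>A \<subseteq> B\<close> by (auto intro!: card_mono)
  \<comment> \<open>The first \<open>N\<close> indices are counted by \<open>a\<close>,
    \<open>b\<close> and the extra pair by \<open>a'\<close>, \<open>b'\<close>. Membership in
    \<open>\<A>\<close> or \<open>\<B>\<close> and the equality \<open>A = B\<close> become
    conditions on these four numbers, so both identities reduce to arithmetic under
    \<open>facts\<close>.\<close>
  define a a' b b' where defs: "a = card (A \<inter> {1..N})" "a' = card (A \<inter> ?p)"
    "b = card (B \<inter> {1..N})" "b' = card (B \<inter> ?p)"
  have facts: "card A = a + a'" "card B = b + b'" "a' \<le> 2" "b' \<le> 2" "a \<le> b" "a' \<le> b'"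
    using split[OF A] split[OF B] p2(1) le unfolding defs by simp_all
  show "of_bool (Suc m \<le> card A) - of_bool (m \<le> card (A \<inter> {1..N})) * of_bool (Suc m \<le> card B)
           = (of_bool (A \<in> \<B>) - of_bool (A \<in> \<A>) + of_bool (A = B \<and> A \<in> \<A>) :: real)"
    unfolding inA[OF A] inB[OF A] AB[symmetric] of_bool_def defs[symmetric] facts(1,2)
    using facts(3-) \<open>0 < m\<close> by (auto split: if_splits)
  show "of_bool (Suc m \<le> card A) - of_bool (m \<le> card (B \<inter> {1..N})) * of_bool (Suc m \<le> card A)
           = (of_bool (A = B \<and> A \<in> \<B>) :: real)"
    unfolding inA[OF A] inB[OF A] AB[symmetric] of_bool_def defs[symmetric] facts(1,2)
    using facts(3-) \<open>0 < m\<close> by (auto split: if_splits)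
qed

text \<open>Writing the formula with \<open>min\<close> and \<open>max\<close> covers both positions
  of \<open>y\<close> relative to \<open>t\<close>: for \<open>t \<le> y\<close> the second term
  vanishes.\<close>

lemma expectation_layer:
  fixes X :: "nat \<Rightarrow> 'a \<Rightarrow> real" and F :: "real \<Rightarrow> real"
  assumes "prob_space M" "prob_space.indep_vars M (\<lambda>_. borel) X {1..Suc (Suc N)}"
    and F: "\<And>i y. i \<in> {1..Suc (Suc N)} \<Longrightarrow> measure M {\<omega> \<in> space M. X i \<omega> \<le> y} = F y"
    and "0 < m" "m \<le> N"
  defines "Y \<equiv> order_stat X m N" and "Z \<equiv> order_stat X (Suc m) (Suc (Suc N))"
  shows "(\<integral>\<omega>. ((if Z \<omega> \<le> y then 1 else 0) - (if Y \<omega> \<le> y then 1 else 0))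
              * indicator {\<omega> \<in> space M. Z \<omega> \<le> t} \<omega> \<partial>M)
         = (N choose (m - 1)) * (F (min y t) ^ Suc m * (1 - F y) ^ (Suc N - m))
           - (N choose m) * (F y ^ m * ((1 - F y) ^ Suc (Suc N - m) - (1 - F (max y t)) ^ Suc (Suc N - m)))"
    (is "(\<integral>\<omega>. ?h \<omega> \<partial>M) = _")
proof -
  interpret prob_space M by fact
  let ?n = "Suc (Suc N)"
  let ?\<A> = "{A. A \<subseteq> {1..N} \<and> card A = m}"
  let ?\<B> = "{A. A \<subseteq> {1..?n} \<and> {Suc N, ?n} \<subseteq> A \<and> card A = Suc m}"
  define E where "E \<A> s r = {\<omega> \<in> space M. below X ?n s \<omega> = below X ?n r \<omega> \<and> below X ?n s \<omega> \<in> \<A>}" for \<A> s r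
  have A: "?\<A> \<subseteq> {A. A \<subseteq> {1..?n} \<and> card A = m}" and B: "?\<B> \<subseteq> {A. A \<subseteq> {1..?n} \<and> card A = Suc m}"
    by auto
  have E: "E ?\<A> s r \<in> events" "prob (E ?\<A> s r) = (N choose m) * (F s ^ m * (1 - F r) ^ Suc (Suc N - m))"
          "E ?\<B> s r \<in> events" "prob (E ?\<B> s r) = (N choose (m - 1)) * (F s ^ Suc m * (1 - F r) ^ (Suc N - m))"
    if "s \<le> r" for s r
    using prob_below[OF assms(1,2) _ F that A] prob_below[OF assms(1,2) _ F that B]
      card_supersets_pair[OF \<open>0 < m\<close>, of N] \<open>m \<le> N\<close>
    unfolding E_def by (simp_all add: n_subsets Suc_diff_le)
  have Zle: "Z \<omega> \<le> y \<longleftrightarrow> Suc m \<le> card (below X ?n y \<omega>)" for \<omega> y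
    unfolding Z_def using \<open>m \<le> N\<close> by (intro order_stat_le_iff) auto
  have Yle: "Y \<omega> \<le> y \<longleftrightarrow> m \<le> card (below X ?n y \<omega> \<inter> {1..N})" for \<omega> y
  proof -
    have "below X ?n y \<omega> \<inter> {1..N} = below X N y \<omega>" by (auto simp: below_def)
    then show ?thesis unfolding Y_def using assms(4,5) by (simp add: order_stat_le_iff)
  qed
  have below_sub: "below X ?n y \<omega> \<subseteq> {1..?n}" for \<omega> y by (auto simp: below_def)
  show ?thesis
  proof (cases "y \<le> t")
    case True
    \<comment> \<open>\<open>Z \<le> y < Y\<close> happens when exactly \<open>m + 1\<close>
      observations lie below \<open>y\<close>, both extra ones among them.
      \<open>Y \<le> y < Z\<close> happens when exactly \<open>m\<close> do, none of them extra. The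
      last indicator undoes the subtraction where \<open>Z > t\<close>, i.e. where no further
      observation falls in \<open>(y, t]\<close>.\<close>
    have "?h \<omega> = indicator (E ?\<B> y y) \<omega> - indicator (E ?\<A> y y) \<omega> + indicator (E ?\<A> y t) \<omega>"
      if "\<omega> \<in> space M" for \<omega>
    proof -
      let ?A = "below X ?n y \<omega>" and ?B = "below X ?n t \<omega>"
      have "card ?A \<le> card ?B" by (rule card_mono[OF finite_below below_mono[OF True]])
      then have "?h \<omega> = of_bool (Suc m \<le> card ?A) - of_bool (m \<le> card (?A \<inter> {1..N})) * of_bool (Suc m \<le> card ?B)"
        using that by (auto simp: Zle Yle of_bool_def)
      also have "\<dots> = of_bool (?A \<in> ?\<B>) - of_bool (?A \<in> ?\<A>) + of_bool (?A = ?B \<and> ?A \<in> ?\<A>)"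
        by (rule removed_pair_cases(1)[OF \<open>0 < m\<close> below_sub below_mono[OF True]])
      finally show ?thesis using that by (simp add: E_def indicator_def of_bool_def)
    qed
    then have "(\<integral>\<omega>. ?h \<omega> \<partial>M) = (\<integral>\<omega>. indicator (E ?\<B> y y) \<omega> - indicator (E ?\<A> y y) \<omega> + indicator (E ?\<A> y t) \<omega> \<partial>M)"
      by (intro Bochner_Integration.integral_cong) auto
    also have "\<dots> = prob (E ?\<B> y y) - prob (E ?\<A> y y) + prob (E ?\<A> y t)"
      using E(1,3)[of y y] E(1)[OF True] by (simp add: emeasure_eq_measure)
    finally show ?thesis using True by (simp only: E[OF order_refl] E[OF True]) (simp add: algebra_simps)
  next
    case False
    then have "t \<le> y" by simp
    \<comment> \<open>Now the event is \<open>Z \<le> t\<close> and \<open>Y > y\<close>: at least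
      \<open>m + 1\<close> observations lie below \<open>t\<close>, but at most \<open>m - 1\<close>
      non-extra ones below \<open>y\<close>, so both counts equal \<open>m + 1\<close>.\<close>
    have "?h \<omega> = indicator (E ?\<B> t y) \<omega>" if "\<omega> \<in> space M" for \<omega>
    proof -
      let ?A = "below X ?n t \<omega>" and ?B = "below X ?n y \<omega>"
      have "card ?A \<le> card ?B" by (rule card_mono[OF finite_below below_mono[OF \<open>t \<le> y\<close>]])
      then have "?h \<omega> = of_bool (Suc m \<le> card ?A) - of_bool (m \<le> card (?B \<inter> {1..N})) * of_bool (Suc m \<le> card ?A)"
        using that by (auto simp: Zle Yle of_bool_def)
      also have "\<dots> = of_bool (?A = ?B \<and> ?A \<in> ?\<B>)"
        by (rule removed_pair_cases(2)[OF \<open>0 < m\<close> below_sub below_mono[OF \<open>t \<le> y\<close>]])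
      finally show ?thesis using that by (simp add: E_def indicator_def of_bool_def)
    qed
    then have "(\<integral>\<omega>. ?h \<omega> \<partial>M) = (\<integral>\<omega>. indicator (E ?\<B> t y) \<omega> \<partial>M)"
      by (intro Bochner_Integration.integral_cong) auto
    also have "\<dots> = prob (E ?\<B> t y)" using E(3)[OF \<open>t \<le> y\<close>] by simp
    finally show ?thesis using False by (simp only: E[OF \<open>t \<le> y\<close>]) simp
  qed
qed

section \<open>The conditional expectation hypothesis tested on the events
  \<open>Z \<le> t\<close>\<close>

lemma subalgebra_vimage_algebra:
  assumes "Z \<in> borel_measurable M"
  shows "subalgebra M (vimage_algebra (space M) Z borel)"
  using assms by (auto simp: subalgebra_def sets_vimage_algebra2 intro: measurable_sets)

text \<open>Integrability of \<open>Z\<close> is inherited from the conditional expectation, with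
  which it agrees almost surely. The second claim is the defining property on
  \<open>Z \<le> t\<close>, an event of the generated algebra.\<close>

lemma cond_exp_given_eq_self:
  fixes Y Z :: "'a \<Rightarrow> real"
  assumes "prob_space M" and [measurable]: "Z \<in> borel_measurable M" and Y: "integrable M Y"
    and eq: "AE \<omega> in M. cond_exp_given M Y Z \<omega> = Z \<omega>"
  shows "integrable M Z"
    and "(\<integral>\<omega>. (Y \<omega> - Z \<omega>) * indicator {\<omega> \<in> space M. Z \<omega> \<le> t} \<omega> \<partial>M) = 0"
proof -
  interpret prob_space M by fact
  let ?G = "vimage_algebra (space M) Z borel"
  let ?C = "{\<omega> \<in> space M. Z \<omega> \<le> t}"
  have sub: "subalgebra M ?G" by (rule subalgebra_vimage_algebra) measurable
  interpret finite_measure_subalgebra M ?G by unfold_locales (rule sub)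
  have int: "integrable M (cond_exp_given M Y Z)"
    unfolding cond_exp_given_def by (rule real_cond_exp_int(1)[OF Y])
  then have [measurable]: "cond_exp_given M Y Z \<in> borel_measurable M" by auto
  show Z: "integrable M Z"
    using eq int by (subst (asm) integrable_cong_AE[where g = Z]) auto
  have C: "?C \<in> sets ?G"
    by (auto simp: sets_vimage_algebra2 intro!: exI[of _ "{..t}"])
  then have C' [measurable]: "?C \<in> sets M" using sub by (auto simp: subalgebra_def)
  have "(\<integral>\<omega>\<in>?C. Y \<omega> \<partial>M) = (\<integral>\<omega>\<in>?C. cond_exp_given M Y Z \<omega> \<partial>M)"
    unfolding cond_exp_given_def by (rule real_cond_exp_intA[OF Y C])
  also have "\<dots> = (\<integral>\<omega>\<in>?C. Z \<omega> \<partial>M)"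
    using eq int unfolding set_lebesgue_integral_def by (intro integral_cong_AE) auto
  finally have "(\<integral>\<omega>\<in>?C. Y \<omega> \<partial>M) - (\<integral>\<omega>\<in>?C. Z \<omega> \<partial>M) = 0" by simp
  also have "(\<integral>\<omega>\<in>?C. Y \<omega> \<partial>M) - (\<integral>\<omega>\<in>?C. Z \<omega> \<partial>M) = (\<integral>\<omega>. Y \<omega> * indicator ?C \<omega> - Z \<omega> * indicator ?C \<omega> \<partial>M)"
    unfolding set_lebesgue_integral_def using Y Z
    by (subst Bochner_Integration.integral_diff)
       (auto intro!: integrable_real_mult_indicator simp: mult.commute)
  finally show "(\<integral>\<omega>. (Y \<omega> - Z \<omega>) * indicator ?C \<omega> \<partial>M) = 0"
    by (simp add: left_diff_distrib)
qed

section \<open>Integrals of powers of the distribution function\<close>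

lemma has_real_derivative_set_integral_upper:
  fixes f :: "real \<Rightarrow> real"
  assumes f: "continuous_on UNIV f" and "s < t"
  shows "((\<lambda>x. LBINT y:{s..x}. f y) has_real_derivative f t) (at t)"
proof -
  have f': "continuous_on A f" for A using f continuous_on_subset by blast
  have "((\<lambda>x. integral {s..x} f) has_real_derivative f t) (at t within {s..t + 1})"
    using assms by (intro integral_has_real_derivative f') auto
  then have "((\<lambda>x. integral {s..x} f) has_real_derivative f t) (at t)"
    using \<open>s < t\<close> by (subst (asm) at_within_Icc_at) auto
  moreover have "(LBINT y:{s..x}. f y) = integral {s..x} f" for x
    by (rule set_borel_integral_eq_integral(2)[OF borel_integrable_atLeastAtMost'[OF f']])
  ultimately show ?thesis by presburger
qed

lemma set_integral_split_point:
  fixes f :: "real \<Rightarrow> real"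
  assumes f: "continuous_on UNIV f" and "s \<le> x"
  shows "set_integrable lborel {..s} f \<Longrightarrow> set_integrable lborel {..x} f"
    and "set_integrable lborel {..s} f \<Longrightarrow> (LBINT y:{..x}. f y) = (LBINT y:{..s}. f y) + (LBINT y:{s..x}. f y)"
    and "set_integrable lborel {s..} f \<Longrightarrow> (LBINT y:{s..}. f y) = (LBINT y:{s..x}. f y) + (LBINT y:{x..}. f y)"
proof -
  have i: "set_integrable lborel {s..x} f"
    using f continuous_on_subset by (intro borel_integrable_atLeastAtMost') blast
  have ae: "AE y in lborel. y \<noteq> z" for z :: real
    by (rule AE_lborel_singleton)
  have U: "{..x} = {..s} \<union> {s..x}" "{s..} = {s..x} \<union> {x..}" using \<open>s \<le> x\<close> by auto
  show "set_integrable lborel {..x} f" if "set_integrable lborel {..s} f"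
    unfolding U by (intro set_integrable_Un that i) auto
  show "(LBINT y:{..x}. f y) = (LBINT y:{..s}. f y) + (LBINT y:{s..x}. f y)" if "set_integrable lborel {..s} f"
    unfolding U using ae[of s] by (intro set_integral_Un_AE that i) auto
  assume a: "set_integrable lborel {s..} f"
  have b: "set_integrable lborel {x..} f"
    by (rule set_integrable_subset[OF a]) (use \<open>s \<le> x\<close> in auto)
  show "(LBINT y:{s..}. f y) = (LBINT y:{s..x}. f y) + (LBINT y:{x..}. f y)"
    unfolding U(2) using ae[of x] by (intro set_integral_Un_AE b i) auto
qed

text \<open>Splitting at \<open>s < t\<close> leaves, near \<open>t\<close>, a constant plus an
  integral over a bounded interval.\<close>

lemma has_real_derivative_set_integral_atMost:
  fixes f :: "real \<Rightarrow> real"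
  assumes f: "continuous_on UNIV f" and i: "set_integrable lborel {..s} f" and "s < t"
  shows "((\<lambda>x. LBINT y:{..x}. f y) has_real_derivative f t) (at t)"
proof (rule has_field_derivative_transform_within[where d = "t - s"])
  show "((\<lambda>x. (LBINT y:{..s}. f y) + (LBINT y:{s..x}. f y)) has_real_derivative f t) (at t)"
    using has_real_derivative_set_integral_upper[OF f \<open>s < t\<close>]
    by (auto intro!: derivative_eq_intros)
  show "(LBINT y:{..s}. f y) + (LBINT y:{s..x}. f y) = (LBINT y:{..x}. f y)" if "dist x t < t - s" for x
    using set_integral_split_point(2)[OF f _ i, of x] that by (simp add: dist_real_def)
qed (use \<open>s < t\<close> in auto)

lemma has_real_derivative_set_integral_atLeast:
  fixes f :: "real \<Rightarrow> real"
  assumes f: "continuous_on UNIV f" and i: "set_integrable lborel {s..} f" and "s < t"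
  shows "((\<lambda>x. LBINT y:{x..}. f y) has_real_derivative - f t) (at t)"
proof (rule has_field_derivative_transform_within[where d = "t - s"])
  show "((\<lambda>x. (LBINT y:{s..}. f y) - (LBINT y:{s..x}. f y)) has_real_derivative - f t) (at t)"
    using has_real_derivative_set_integral_upper[OF f \<open>s < t\<close>]
    by (auto intro!: derivative_eq_intros)
  show "(LBINT y:{s..}. f y) - (LBINT y:{s..x}. f y) = (LBINT y:{x..}. f y)" if "dist x t < t - s" for x
    using set_integral_split_point(3)[OF f _ i, of x] that by (simp add: dist_real_def)
qed (use \<open>s < t\<close> in auto)

text \<open>The difference quotient of \<open>F\<close> is that of the composition divided by that
  of \<open>g\<close>. This derives differentiability of \<open>F\<close> instead of presupposing
  it.\<close>

lemma DERIV_cancel_outer: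
  fixes F g :: "real \<Rightarrow> real"
  assumes gF: "((\<lambda>x. g (F x)) has_real_derivative d) (at t)"
    and g: "(g has_real_derivative g') (at (F t))" "g' \<noteq> 0"
    and F: "isCont F t" "\<forall>\<^sub>F x in at t. F x \<noteq> F t"
  shows "(F has_real_derivative d / g') (at t)"
proof -
  \<comment> \<open>\<open>F x\<close> tends to \<open>F t\<close> while avoiding it, so the
    quotient of \<open>g\<close> may be evaluated along \<open>F\<close>.\<close>
  have "filterlim F (at (F t)) (at t)"
    using F by (auto simp: isCont_def intro: filterlim_atI)
  then have "((\<lambda>x. (g (F x) - g (F t)) / (F x - F t)) \<longlongrightarrow> g') (at t)"
    using g(1) unfolding has_field_derivative_iff by (rule filterlim_compose[rotated])
  then have "((\<lambda>x. ((g (F x) - g (F t)) / (x - t)) / ((g (F x) - g (F t)) / (F x - F t))) \<longlongrightarrow> d / g') (at t)"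
    using gF g(2) unfolding has_field_derivative_iff by (intro tendsto_divide)
  moreover have "\<forall>\<^sub>F x in at t. (g (F x) - g (F t)) / (F x - F t) \<noteq> 0"
    using \<open>((\<lambda>x. (g (F x) - g (F t)) / (F x - F t)) \<longlongrightarrow> g') (at t)\<close> g(2)
    by (rule tendsto_imp_eventually_ne)
  then have "\<forall>\<^sub>F x in at t. ((g (F x) - g (F t)) / (x - t)) / ((g (F x) - g (F t)) / (F x - F t))
                = (F x - F t) / (x - t)"
    by eventually_elim auto
  ultimately show ?thesis
    unfolding has_field_derivative_iff by (simp cong: tendsto_cong)
qed

text \<open>The integrand is \<open>P(Z \<le> y, Z \<le> t) - P(Y \<le> y, Z \<le> t)\<close>, where \<open>c1\<close> and \<open>c2\<close> become the binomial
  coefficients \<open>n - 2\<close> over \<open>m\<close> and \<open>n - 2\<close> over \<open>m - 1\<close>.\<close>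
locale balanced_cdf =
  fixes F :: "real \<Rightarrow> real" and m k :: nat and c1 c2 :: real
  assumes mono_F: "mono F" and cont_F: "continuous_on UNIV F"
    and F_nonneg: "0 \<le> F x" and F_le_1: "F x \<le> 1"
    and F_at_bot: "(F \<longlongrightarrow> 0) at_bot"
    and F_less: "\<lbrakk>x < y; 0 < F x; F y < 1\<rbrakk> \<Longrightarrow> F x < F y"
    and m_pos: "0 < m" and k_pos: "0 < k" and c1_pos: "0 < c1" and c2_pos: "0 < c2"
    and layer_integrable: "integrable lborel
      (\<lambda>y. c2 * (F (min y t) ^ Suc m * (1 - F y) ^ k)
         - c1 * (F y ^ m * ((1 - F y) ^ Suc k - (1 - F (max y t)) ^ Suc k)))"
    and layer_integral: "(\<integral>y. c2 * (F (min y t) ^ Suc m * (1 - F y) ^ k)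
         - c1 * (F y ^ m * ((1 - F y) ^ Suc k - (1 - F (max y t)) ^ Suc k)) \<partial>lborel) = 0"
begin

abbreviation "layer t y \<equiv> c2 * (F (min y t) ^ Suc m * (1 - F y) ^ k)
         - c1 * (F y ^ m * ((1 - F y) ^ Suc k - (1 - F (max y t)) ^ Suc k))"

definition "P t = (LBINT y:{..t}. F y ^ m)"
definition "S t = (LBINT y:{t..}. (1 - F y) ^ k)"
text \<open>The integrand is the part of \<open>layer t\<close> on \<open>{..t}\<close> that depends
  on \<open>y\<close> alone; the remainder there is \<open>F y ^ m\<close> times a factor depending
  only on \<open>t\<close>.\<close>

definition "A t = (LBINT y:{..t}. c2 * (F y ^ Suc m * (1 - F y) ^ k) - c1 * (F y ^ m * (1 - F y) ^ Suc k))"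
definition "\<kappa> = c2 * Suc m / (c1 * Suc k)"

lemma isCont_F: "isCont F x"
  using cont_F by (simp add: continuous_on_eq_continuous_at)

lemma F_le: "x \<le> y \<Longrightarrow> F x \<le> F y"
  using mono_F by (rule monoD)

lemma continuous_F_intros:
  "continuous_on UNIV (\<lambda>y. F y ^ m)" "continuous_on UNIV (\<lambda>y. (1 - F y) ^ k)"
  "continuous_on UNIV (\<lambda>y. c2 * (F y ^ Suc m * (1 - F y) ^ k) - c1 * (F y ^ m * (1 - F y) ^ Suc k))"
  by (intro continuous_intros cont_F)+

lemma F_borel [measurable]: "F \<in> borel_measurable borel"
  using cont_F by (rule borel_measurable_continuous_onI)

text \<open>To the right of \<open>t\<close> the layer is a constant multiple of this integrand, and
  \<open>0 < F t\<close> makes the constant positive.\<close>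

lemma integrable_S:
  assumes "0 < F t"
  shows "set_integrable lborel {t..} (\<lambda>y. (1 - F y) ^ k)"
proof -
  have "set_integrable lborel {t..} (layer t)"
    unfolding set_integrable_def using layer_integrable[of t]
    by (intro integrable_mult_indicator) auto
  moreover have "layer t y = (c2 * F t ^ Suc m) * (1 - F y) ^ k" if "y \<in> {t..}" for y
    using that by (simp add: min_absorb2 max_absorb1)
  ultimately have "set_integrable lborel {t..} (\<lambda>y. (c2 * F t ^ Suc m) * (1 - F y) ^ k)"
    by (subst set_integrable_cong[where f' = "layer t"]) auto
  then show ?thesis using assms c2_pos by simp
qed

text \<open>Near \<open>-\<infinity>\<close> the integrand is \<open>F\<^sup>m\<close> times a factor bounded away from 0.\<close>
lemma integrable_P:
  assumes "0 < F t"
  shows "set_integrable lborel {..t} (\<lambda>y. F y ^ m)"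
proof -
  \<comment> \<open>Below \<open>t\<close> the layer is \<open>F y ^ m\<close> times
    \<open>?\<phi> (F y)\<close>, and \<open>e\<close> is chosen so that
    \<open>?\<phi> 0 = - 2 * e\<close>; hence \<open>\<bar>?\<phi> (F y)\<bar>\<close> exceeds
    \<open>e\<close> far to the left.\<close>
  define e where "e = c1 * (1 - (1 - F t) ^ Suc k) / 2"
  let ?\<phi> = "\<lambda>u. c2 * (u * (1 - u) ^ k) - c1 * ((1 - u) ^ Suc k - (1 - F t) ^ Suc k)"
  have "(1 - F t) ^ Suc k \<le> 1 - F t"
    using assms F_le_1[of t] by (intro power_Suc_le_self) auto
  then have "(1 - F t) ^ Suc k < 1" using assms by linarith
  then have "e > 0" using c1_pos by (simp add: e_def)
  have "((\<lambda>y. ?\<phi> (F y)) \<longlongrightarrow> ?\<phi> 0) at_bot"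
    by (intro tendsto_intros F_at_bot)
  moreover have "?\<phi> 0 = - (2 * e)" by (simp add: e_def field_simps del: power_Suc)
  then have "?\<phi> 0 < - e" using \<open>e > 0\<close> by linarith
  ultimately have "\<forall>\<^sub>F y in at_bot. ?\<phi> (F y) < - e" by (rule order_tendstoD)
  then obtain s' where s': "\<And>y. y \<le> s' \<Longrightarrow> ?\<phi> (F y) < - e"
    by (auto simp: eventually_at_bot_linorder)
  define s where "s = min s' t"
  have bound: "F y ^ m \<le> \<bar>layer t y\<bar> / e" if "y \<le> s" for y
  proof -
    have "e \<le> \<bar>?\<phi> (F y)\<bar>" using s'[of y] that by (simp add: s_def)
    then have "F y ^ m * e \<le> F y ^ m * \<bar>?\<phi> (F y)\<bar>"
      using F_nonneg by (intro mult_left_mono) auto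
    also have "\<dots> = \<bar>F y ^ m * ?\<phi> (F y)\<bar>" using F_nonneg by (simp add: abs_mult)
    also have "F y ^ m * ?\<phi> (F y) = layer t y"
      using that by (simp add: s_def min_absorb1 max_absorb2 algebra_simps)
    finally show ?thesis using \<open>e > 0\<close> by (simp add: field_simps)
  qed
  have "integrable lborel (\<lambda>y. layer t y / e)" using layer_integrable[of t] by simp
  then have "set_integrable lborel {..s} (\<lambda>y. F y ^ m)"
    unfolding set_integrable_def
    by (rule Bochner_Integration.integrable_bound)
       (use bound \<open>e > 0\<close> F_nonneg in \<open>auto simp: indicator_def abs_divide intro!: AE_I2\<close>)
  then show ?thesis
    by (rule set_integral_split_point(1)[OF continuous_F_intros(1), rotated]) (simp add: s_def)
qed

text \<open>Since \<open>0 \<le> F \<le> 1\<close>, the integrand is dominated by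
  \<open>(c2 + c1) * F y ^ m\<close>.\<close>

lemma integrable_A:
  assumes "0 < F t"
  shows "set_integrable lborel {..t} (\<lambda>y. c2 * (F y ^ Suc m * (1 - F y) ^ k) - c1 * (F y ^ m * (1 - F y) ^ Suc k))"
proof -
  have "set_integrable lborel {..t} (\<lambda>y. (c2 + c1) * F y ^ m)"
    using integrable_P[OF assms] by simp
  then show ?thesis
  proof (rule set_integrable_bound)
    have "norm (c2 * (u ^ Suc m * (1 - u) ^ k) - c1 * (u ^ m * (1 - u) ^ Suc k)) \<le> norm ((c2 + c1) * u ^ m)"
      if "0 \<le> u" "u \<le> 1" for u :: real
    proof -
      have "u * (1 - u) ^ k \<le> 1" "(1 - u) ^ Suc k \<le> 1"
        using that by (auto intro!: mult_le_one power_le_one simp del: power_Suc)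
      then have "u ^ m * (u * (1 - u) ^ k) \<le> u ^ m" "u ^ m * (1 - u) ^ Suc k \<le> u ^ m"
        using that by (simp_all add: mult_left_le del: power_Suc)
      then have "c2 * (u ^ m * (u * (1 - u) ^ k)) \<le> c2 * u ^ m" "c1 * (u ^ m * (1 - u) ^ Suc k) \<le> c1 * u ^ m"
        using c1_pos c2_pos by simp_all
      moreover have "0 \<le> c2 * (u ^ m * (u * (1 - u) ^ k))" "0 \<le> c1 * (u ^ m * (1 - u) ^ Suc k)"
          "0 \<le> c2 * u ^ m" "0 \<le> c1 * u ^ m"
        using that c1_pos c2_pos by simp_all
      ultimately show ?thesis by (simp add: algebra_simps abs_le_iff)
    qed
    then show "AE x in lborel. x \<in> {..t} \<longrightarrow> norm (c2 * (F x ^ Suc m * (1 - F x) ^ k) - c1 * (F x ^ m * (1 - F x) ^ Suc k))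
           \<le> norm ((c2 + c1) * F x ^ m)"
      using F_nonneg F_le_1 by blast
  qed (simp add: set_borel_measurable_def)
qed

text \<open>The vanishing integral of the layer is split at \<open>t\<close>; the common endpoint is
  a null set.\<close>

lemma split_identity:
  assumes "0 < F t"
  shows "A t + c1 * (1 - F t) ^ Suc k * P t + c2 * F t ^ Suc m * S t = 0"
proof -
  let ?a = "\<lambda>y. c2 * (F y ^ Suc m * (1 - F y) ^ k) - c1 * (F y ^ m * (1 - F y) ^ Suc k)"
  have L: "layer t y = ?a y + c1 * (1 - F t) ^ Suc k * F y ^ m" if "y \<in> {..t}" for y
    using that by (simp add: min_absorb1 max_absorb2 algebra_simps)
  have U: "layer t y = c2 * F t ^ Suc m * (1 - F y) ^ k" if "y \<in> {t..}" for y
    using that by (simp add: min_absorb2 max_absorb1)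
  have i: "set_integrable lborel B (layer t)" if "B \<in> sets lborel" for B
    unfolding set_integrable_def using layer_integrable[of t] that
    by (intro integrable_mult_indicator) auto
  have "0 = (LBINT y:{..t} \<union> {t..}. layer t y)"
  proof -
    have "{..t} \<union> {t..} = UNIV" by auto
    then show ?thesis using layer_integral[of t] by (simp only: set_lebesgue_integral_def) simp
  qed
  also have "\<dots> = (LBINT y:{..t}. layer t y) + (LBINT y:{t..}. layer t y)"
    using AE_lborel_singleton[of t] by (intro set_integral_Un_AE i) auto
  also have "(LBINT y:{..t}. layer t y) = (LBINT y:{..t}. ?a y + c1 * (1 - F t) ^ Suc k * F y ^ m)"
    by (intro set_lebesgue_integral_cong) (use L in auto)
  also have "\<dots> = A t + c1 * (1 - F t) ^ Suc k * P t"
    unfolding A_def P_def using integrable_A[OF assms] integrable_P[OF assms]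
    by (subst set_integral_add) auto
  also have "(LBINT y:{t..}. layer t y) = (LBINT y:{t..}. c2 * F t ^ Suc m * (1 - F y) ^ k)"
    by (intro set_lebesgue_integral_cong) (use U in auto)
  also have "\<dots> = c2 * F t ^ Suc m * S t" unfolding S_def by simp
  finally show ?thesis by simp
qed

lemma ex_less_pos:
  assumes "0 < F t"
  shows "\<exists>s<t. 0 < F s"
proof -
  have "\<forall>\<^sub>F x in at_left t. 0 < F x"
    using isCont_F[of t] assms by (metis continuous_at_imp_continuous_at_within continuous_within order_tendstoD(1))
  then have "\<forall>\<^sub>F x in at_left t. x < t \<and> 0 < F x"
    by (auto simp: eventually_at_filter elim: eventually_mono)
  then show ?thesis using eventually_happens by fastforce
qed

lemma ex_greater_less_1:
  assumes "F t < 1"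
  shows "\<exists>s>t. F s < 1"
proof -
  have "\<forall>\<^sub>F x in at_right t. F x < 1"
    using isCont_F[of t] assms by (metis continuous_at_imp_continuous_at_within continuous_within order_tendstoD(2))
  then have "\<forall>\<^sub>F x in at_right t. x > t \<and> F x < 1"
    by (auto simp: eventually_at_filter elim: eventually_mono)
  then show ?thesis using eventually_happens by fastforce
qed

text \<open>Continuity of \<open>F\<close> supplies \<open>s < t\<close> with
  \<open>0 < F s\<close>, so all the integrals already exist from a point left of
  \<open>t\<close>.\<close>

lemma derivatives:
  assumes "0 < F t"
  shows "(P has_real_derivative F t ^ m) (at t)"
    and "(S has_real_derivative - ((1 - F t) ^ k)) (at t)"
    and "(A has_real_derivative c2 * (F t ^ Suc m * (1 - F t) ^ k) - c1 * (F t ^ m * (1 - F t) ^ Suc k)) (at t)"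
proof -
  obtain s where s: "s < t" "0 < F s" using ex_less_pos[OF assms] by blast
  show "(P has_real_derivative F t ^ m) (at t)"
    unfolding P_def[abs_def]
    by (rule has_real_derivative_set_integral_atMost[OF continuous_F_intros(1) integrable_P[OF s(2)] s(1)])
  show "(S has_real_derivative - ((1 - F t) ^ k)) (at t)"
    unfolding S_def[abs_def]
    by (rule has_real_derivative_set_integral_atLeast[OF continuous_F_intros(2) integrable_S[OF s(2)] s(1)])
  show "(A has_real_derivative c2 * (F t ^ Suc m * (1 - F t) ^ k) - c1 * (F t ^ m * (1 - F t) ^ Suc k)) (at t)"
    unfolding A_def[abs_def]
    by (rule has_real_derivative_set_integral_atMost[OF continuous_F_intros(3) integrable_A[OF s(2)] s(1)])
qed

end

section \<open>The balance relation and the differential equation for \<open>F\<close>\<close>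

context balanced_cdf
begin

text \<open>With \<open>F s = v\<close> frozen, the derivative of \<open>\<psi>\<close> vanishes at \<open>s\<close> and is \<open>O(F z - v)\<close> at \<open>z\<close>. The
  increment of the left-hand side of \<open>split_identity\<close> between \<open>s\<close> and \<open>x\<close>, divided by \<open>F x - v\<close>, is therefore \<open>L x\<close> up to
  \<open>O(x - s)\<close>.\<close>
lemma balance:
  assumes s: "0 < F s" "F s < 1"
  shows "c1 * Suc k * (1 - F s) ^ k * P s = c2 * Suc m * F s ^ m * S s"
proof -
  define v where "v = F s"
  \<comment> \<open>\<open>C\<close> collects the constants from bounding the differences of the
    powers \<open>Suc m\<close> and \<open>Suc k\<close> by multiples of the difference of their
    bases.\<close>
  define C where "C = c2 * Suc m + c1 * Suc k"
  have "C > 0" using c1_pos c2_pos by (simp add: C_def add_pos_pos)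
  define \<psi> where "\<psi> x = A x + c1 * (1 - v) ^ Suc k * P x + c2 * v ^ Suc m * S x" for x
  define L where "L x = c1 * (((1 - F x) ^ Suc k - (1 - v) ^ Suc k) / (F x - v)) * P x
                      + c2 * ((F x ^ Suc m - v ^ Suc m) / (F x - v)) * S x" for x
  obtain r where r: "s < r" "F r < 1" using ex_greater_less_1[OF s(2)] by blast
  have near: "v < F x" "F x < 1" if "s < x" "x < r" for x
    using F_less[OF that(1)] F_le[of x r] s r that by (auto simp: v_def)
  have L_bound: "\<bar>L x\<bar> \<le> C * (x - s)" if x: "s < x" "x < r" for x
  proof -
    define \<psi>' where "\<psi>' z = c2 * ((F z ^ Suc m - v ^ Suc m) * (1 - F z) ^ k)
                            + c1 * (F z ^ m * ((1 - v) ^ Suc k - (1 - F z) ^ Suc k))" for z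
    have der: "(\<psi> has_real_derivative \<psi>' z) (at z)" if "s \<le> z" for z
    proof -
      have "0 < F z" using F_le[OF that] s by simp
      then show ?thesis unfolding \<psi>_def[abs_def] \<psi>'_def
        by (auto intro!: derivative_eq_intros derivatives simp: algebra_simps)
    qed
    obtain z where z: "s < z" "z < x" "\<psi> x - \<psi> s = (x - s) * \<psi>' z"
      using MVT2[OF x(1), of \<psi> \<psi>'] der by auto
    have "v \<le> F z" "F z \<le> F x" using z F_le[of s z] F_le[of z x] by (auto simp: v_def)
    have p1: "\<bar>F z ^ Suc m - v ^ Suc m\<bar> \<le> Suc m * (F z - v)"
      using norm_power_diff[of "F z" v "Suc m"] F_nonneg F_le_1 \<open>v \<le> F z\<close> by (simp add: v_def del: power_Suc)
    have p2: "\<bar>(1 - v) ^ Suc k - (1 - F z) ^ Suc k\<bar> \<le> Suc k * (F z - v)"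
      using norm_power_diff[of "1 - v" "1 - F z" "Suc k"] F_nonneg F_le_1 \<open>v \<le> F z\<close> by (simp add: v_def del: power_Suc)
    have "\<bar>(F z ^ Suc m - v ^ Suc m) * (1 - F z) ^ k\<bar> \<le> Suc m * (F z - v) * 1"
      unfolding abs_mult using F_nonneg[of z] F_le_1[of z] \<open>v \<le> F z\<close>
      by (intro mult_mono p1) (auto intro: power_le_one)
    moreover have "\<bar>F z ^ m * ((1 - v) ^ Suc k - (1 - F z) ^ Suc k)\<bar> \<le> 1 * (Suc k * (F z - v))"
      unfolding abs_mult using F_nonneg[of z] F_le_1[of z]
      by (intro mult_mono p2) (auto intro: power_le_one)
    ultimately have "\<bar>\<psi>' z\<bar> \<le> c2 * (Suc m * (F z - v)) + c1 * (Suc k * (F z - v))"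
      unfolding \<psi>'_def using c1_pos c2_pos
      by (intro order_trans[OF abs_triangle_ineq] add_mono) (simp_all add: abs_mult del: power_Suc)
    also have "\<dots> = C * (F z - v)" by (simp add: C_def algebra_simps)
    also have "\<dots> \<le> C * (F x - v)" using \<open>C > 0\<close> \<open>F z \<le> F x\<close> by simp
    finally have "\<bar>\<psi> x - \<psi> s\<bar> \<le> (x - s) * (C * (F x - v))"
      unfolding z(3) abs_mult using x by (intro mult_mono) auto
    moreover have "\<psi> s = 0" using split_identity[OF s(1)] by (simp add: \<psi>_def v_def)
    \<comment> \<open>Subtracting \<open>split_identity\<close> at \<open>x\<close> cancels
      \<open>A x\<close> and leaves only differences of powers.\<close>
    moreover have "\<psi> x = - (L x * (F x - v))"
    proof -
      have "0 < F x" using near[OF x] s by (simp add: v_def)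
      from split_identity[OF this] have "\<psi> x = - (c1 * ((1 - F x) ^ Suc k - (1 - v) ^ Suc k) * P x
              + c2 * (F x ^ Suc m - v ^ Suc m) * S x)"
        unfolding \<psi>_def by (simp add: left_diff_distrib right_diff_distrib del: power_Suc)
      also have "\<dots> = - (L x * (F x - v))"
        using near[OF x] unfolding L_def by (simp add: distrib_right del: power_Suc)
      finally show ?thesis .
    qed
    ultimately have "\<bar>L x\<bar> * (F x - v) \<le> (C * (x - s)) * (F x - v)"
      using near[OF x] by (simp add: abs_mult mult_ac)
    then show ?thesis using near[OF x] by simp
  qed
  have ev: "\<forall>\<^sub>F x in at_right s. s < x \<and> x < r"
    using eventually_at_right_real[OF r(1)] by simp
  \<comment> \<open>The right limit of \<open>L\<close> at \<open>s\<close> is found twice: the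
    bound gives 0, the difference quotients of the two powers give the difference of the two sides
    of the claim up to sign.\<close>
  have "(L \<longlongrightarrow> 0) (at_right s)"
  proof (rule Lim_null_comparison)
    show "\<forall>\<^sub>F x in at_right s. norm (L x) \<le> C * (x - s)"
      using ev by eventually_elim (simp add: L_bound)
    have "((\<lambda>x. C * (x - s)) \<longlongrightarrow> C * (s - s)) (at_right s)"
      by (intro tendsto_intros)
    then show "((\<lambda>x. C * (x - s)) \<longlongrightarrow> 0) (at_right s)" by simp
  qed
  moreover have "(L \<longlongrightarrow> c1 * (- (Suc k * (1 - v) ^ k)) * P s + c2 * (Suc m * v ^ m) * S s) (at_right s)"
  proof -
    have tend: "(G \<longlongrightarrow> G s) (at_right s)" if "isCont G s" for G :: "real \<Rightarrow> real"
      using that by (simp add: continuous_at_imp_continuous_at_within flip: continuous_within)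
    have F: "filterlim F (at v) (at_right s)"
    proof (rule filterlim_atI)
      show "(F \<longlongrightarrow> v) (at_right s)" unfolding v_def by (rule tend[OF isCont_F])
      show "\<forall>\<^sub>F x in at_right s. F x \<noteq> v"
        using ev by eventually_elim (use near in force)
    qed
    have "((\<lambda>u. (1 - u) ^ Suc k) has_real_derivative - (Suc k * (1 - v) ^ k)) (at v)"
         "((\<lambda>u. u ^ Suc m) has_real_derivative Suc m * v ^ m) (at v)"
      by (auto intro!: derivative_eq_intros simp del: power_Suc)
    then have "((\<lambda>x. ((1 - F x) ^ Suc k - (1 - v) ^ Suc k) / (F x - v)) \<longlongrightarrow> - (Suc k * (1 - v) ^ k)) (at_right s)"
      "((\<lambda>x. (F x ^ Suc m - v ^ Suc m) / (F x - v)) \<longlongrightarrow> Suc m * v ^ m) (at_right s)"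
      unfolding has_field_derivative_iff by (auto intro: filterlim_compose[OF _ F])
    then show ?thesis
      unfolding L_def[abs_def]
      using tend[OF DERIV_isCont[OF derivatives(1)[OF s(1)]]] tend[OF DERIV_isCont[OF derivatives(2)[OF s(1)]]]
      by (intro tendsto_intros)
  qed
  ultimately have "0 = c1 * (- (Suc k * (1 - v) ^ k)) * P s + c2 * (Suc m * v ^ m) * S s"
    by (rule tendsto_unique[rotated]) simp
  then show ?thesis by (simp add: v_def algebra_simps)
qed

text \<open>\<open>P\<close> is nonnegative and strictly increasing wherever \<open>F\<close> is
  positive, which already holds slightly left of \<open>t\<close>.\<close>

lemma P_pos:
  assumes "0 < F t"
  shows "0 < P t"
proof -
  obtain s where s: "s < t" "0 < F s" using ex_less_pos[OF assms] by blast
  have "P s < P t"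
  proof (rule DERIV_pos_imp_increasing[OF s(1)])
    fix x assume "s \<le> x"
    then have "0 < F x" using F_le[of s x] s by simp
    then show "\<exists>y. DERIV P x :> y \<and> 0 < y" using derivatives(1)[of x] by auto
  qed
  moreover have "0 \<le> P s"
    unfolding P_def set_lebesgue_integral_def using F_nonneg by (intro Bochner_Integration.integral_nonneg) auto
  ultimately show ?thesis by simp
qed

lemma kappa_pos: "0 < \<kappa>"
  using c1_pos c2_pos by (simp add: \<kappa>_def)

lemma balance_kappa:
  assumes "0 < F t" "F t < 1"
  shows "(1 - F t) ^ k * P t = \<kappa> * F t ^ m * S t" "0 < S t"
proof -
  show eq: "(1 - F t) ^ k * P t = \<kappa> * F t ^ m * S t"
    using balance[OF assms] c1_pos by (simp add: \<kappa>_def field_simps del: of_nat_Suc)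
  have "0 < (1 - F t) ^ k * P t" using P_pos assms by simp
  then show "0 < S t" unfolding eq
    by (rule zero_less_mult_pos) (use kappa_pos assms in simp)
qed

lemma F_eq_iff: "\<lbrakk>0 < F t; F t < 1; x \<noteq> t\<rbrakk> \<Longrightarrow> F x \<noteq> F t"
  using F_less[of x t] F_less[of t x] by (metis linorder_neqE less_irrefl)

text \<open>Taking logarithms in the balance relation expresses
  \<open>m * ln F - k * ln (1 - F)\<close> through \<open>ln P - ln S\<close>, which is
  differentiable; the outer function of \<open>F\<close> has positive slope and can be
  cancelled.\<close>

lemma F_derivative:
  assumes t: "0 < F t" "F t < 1"
  shows "(F has_real_derivative (1 + \<kappa>) * F t ^ m / P t / (m / F t + k / (1 - F t))) (at t)"
proof -
  let ?g = "\<lambda>u. m * ln u - k * ln (1 - u)"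
  have g: "(?g has_real_derivative m / F t + k / (1 - F t)) (at (F t))"
    using t by (auto intro!: derivative_eq_intros simp: field_simps)
  have nz: "m / F t + k / (1 - F t) \<noteq> 0"
    using t m_pos k_pos by (intro less_imp_neq[symmetric] add_pos_pos) auto
  have gF: "((\<lambda>x. ?g (F x)) has_real_derivative (1 + \<kappa>) * F t ^ m / P t) (at t)"
  proof -
    have "((\<lambda>x. ln (P x) - ln (S x) - ln \<kappa>) has_real_derivative F t ^ m / P t + (1 - F t) ^ k / S t) (at t)"
      using P_pos[OF t(1)] balance_kappa(2)[OF t]
      by (auto intro!: derivative_eq_intros derivatives t simp: field_simps)
    \<comment> \<open>The balance relation eliminates \<open>S\<close>, leaving an equation in
      \<open>F\<close> and \<open>P\<close> only.\<close>
    moreover have "(1 - F t) ^ k / S t = \<kappa> * F t ^ m / P t"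
      using P_pos[OF t(1)] balance_kappa[OF t] by (simp add: field_simps)
    ultimately have d: "((\<lambda>x. ln (P x) - ln (S x) - ln \<kappa>) has_real_derivative (1 + \<kappa>) * F t ^ m / P t) (at t)"
      by (simp add: add_divide_distrib distrib_right)
    have "(F \<longlongrightarrow> F t) (nhds t)"
      using isCont_F[of t] by (simp add: isCont_def tendsto_at_iff_tendsto_nhds)
    then have "\<forall>\<^sub>F x in nhds t. 0 < F x \<and> F x < 1"
      using t by (intro eventually_conj order_tendstoD[of F "F t"])
    moreover have "?g (F x) = ln (P x) - ln (S x) - ln \<kappa>" if x: "0 < F x" "F x < 1" for x
    proof -
      have "ln ((1 - F x) ^ k * P x) = ln (\<kappa> * F x ^ m * S x)" using balance_kappa(1)[OF x] by simp
      then show ?thesis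
        using x P_pos[OF x(1)] balance_kappa(2)[OF x] kappa_pos by (simp add: ln_mult ln_realpow)
    qed
    ultimately have "\<forall>\<^sub>F x in nhds t. ?g (F x) = ln (P x) - ln (S x) - ln \<kappa>"
      by (simp add: eventually_mono)
    then show ?thesis using d by (subst DERIV_cong_ev[OF refl _ refl])
  qed
  have "\<forall>\<^sub>F x in at t. F x \<noteq> F t"
    using F_eq_iff[OF t] by (simp add: eventually_at_filter)
  then show ?thesis by (rule DERIV_cancel_outer[where g = ?g, OF gF g nz isCont_F])
qed

text \<open>The exponent \<open>\<lambda>\<close> of the informal statement.\<close>
definition "\<theta> = \<kappa> / (1 + \<kappa>)"

text \<open>By \<open>F_derivative\<close>, \<open>P' / P\<close> is \<open>1 - \<theta>\<close>
  times the derivative of \<open>m * ln F - k * ln (1 - F)\<close>. Hence \<open>l\<close> is a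
  first integral, which gives \<open>P\<close> as an explicit function of \<open>F\<close> and
  closes the equation.\<close>

lemma F_derivative_eq:
  assumes ex: "\<exists>t. 0 < F t \<and> F t < 1"
  shows "\<exists>c>0. \<forall>t. 0 < F t \<and> F t < 1 \<longrightarrow>
     (F has_real_derivative 1 / (c * ((m + (real k - m) * F t)
        / (F t powr (1 + m * \<theta>) * (1 - F t) powr (1 + k * (1 - \<theta>)))))) (at t)"
proof -
  define I where "I = {t. 0 < F t \<and> F t < 1}"
  define l where "l x = ln (P x) - m * (1 - \<theta>) * ln (F x) + k * (1 - \<theta>) * ln (1 - F x)" for x
  have lam: "(1 - \<theta>) * (1 + \<kappa>) = 1" using kappa_pos by (simp add: \<theta>_def field_simps)
  have "\<theta> < 1" using kappa_pos by (simp add: \<theta>_def)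
  \<comment> \<open>Convexity of \<open>I\<close> makes \<open>l\<close> one and the same constant
    on all of it.\<close>
  have "is_interval I"
    unfolding is_interval_1 I_def using F_le by (auto intro: less_le_trans le_less_trans)
  then have "convex I" by (simp add: is_interval_convex_1)
  moreover have "(l has_real_derivative 0) (at t within I)" if "t \<in> I" for t
  proof -
    have t: "0 < F t" "F t < 1" using that by (auto simp: I_def)
    define w where "w = m / F t + k / (1 - F t)"
    define d where "d = (1 + \<kappa>) * F t ^ m / P t / w"
    have "w > 0" using t m_pos k_pos by (simp add: w_def add_pos_pos)
    have dw: "(1 - \<theta>) * (d * w) = F t ^ m / P t"
      using lam \<open>w > 0\<close> by (simp add: d_def mult.assoc[symmetric])
    have "(F has_real_derivative d) (at t)" using F_derivative[OF t] unfolding d_def w_def .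
    then have "(l has_real_derivative
        F t ^ m / P t - m * (1 - \<theta>) * (d / F t) + k * (1 - \<theta>) * (- d / (1 - F t))) (at t)"
      unfolding l_def[abs_def] using t P_pos[OF t(1)]
      by (auto intro!: derivative_eq_intros derivatives simp: mult.commute)
    also have "F t ^ m / P t - m * (1 - \<theta>) * (d / F t) + k * (1 - \<theta>) * (- d / (1 - F t))
        = F t ^ m / P t - (1 - \<theta>) * (d * w)"
    proof -
      have "A - m * p * (d / u) + k * p * (- d / v) = A - p * (d * (m / u + k / v))" for A p u v :: real
        by (simp add: algebra_simps)
      then show ?thesis unfolding w_def .
    qed
    finally have "(l has_real_derivative F t ^ m / P t - (1 - \<theta>) * (d * w)) (at t)" .
    then show ?thesis unfolding dw using has_field_derivative_at_within by simp
  qed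
  ultimately obtain cl where cl: "\<And>x. x \<in> I \<Longrightarrow> l x = cl"
    using has_field_derivative_zero_constant by metis
  \<comment> \<open>The factor \<open>exp cl\<close> is the constant in \<open>P\<close>, and
    \<open>1 - \<theta>\<close> is the reciprocal of \<open>1 + \<kappa>\<close>.\<close>
  define c where "c = exp cl * (1 - \<theta>)"
  have "c > 0" using \<open>\<theta> < 1\<close> by (simp add: c_def)
  moreover have "(F has_real_derivative 1 / (c * ((m + (real k - m) * F t)
        / (F t powr (1 + m * \<theta>) * (1 - F t) powr (1 + k * (1 - \<theta>)))))) (at t)"
    if t: "0 < F t" "F t < 1" for t
  proof -
    let ?u = "F t"
    have "ln (P t) = cl + m * (1 - \<theta>) * ln ?u - k * (1 - \<theta>) * ln (1 - ?u)"
      using cl[of t] t by (simp add: I_def l_def)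
    then have "P t = exp (cl + m * (1 - \<theta>) * ln ?u - k * (1 - \<theta>) * ln (1 - ?u))"
      using P_pos[OF t(1)] by (metis exp_ln)
    also have "\<dots> = exp cl * ?u powr (m * (1 - \<theta>)) / (1 - ?u) powr (k * (1 - \<theta>))"
      using t by (simp add: powr_def exp_add exp_diff)
    \<comment> \<open>Splitting off \<open>?u ^ m\<close> lets it cancel against the numerator of
      the derivative of \<open>F\<close>, which turns the exponent \<open>m * (1 - \<theta>)\<close>
      into \<open>m * \<theta>\<close>.\<close>
    also have "?u powr (m * (1 - \<theta>)) = ?u ^ m / ?u powr (m * \<theta>)"
      using t by (simp add: right_diff_distrib powr_diff powr_realpow)
    finally have P: "P t = exp cl * (?u ^ m / ?u powr (m * \<theta>)) / (1 - ?u) powr (k * (1 - \<theta>))" .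
    have w: "m / ?u + k / (1 - ?u) = (m + (real k - m) * ?u) / (?u * (1 - ?u))"
      using t by (simp add: field_simps)
    have pos: "m + (real k - m) * ?u > 0"
    proof -
      have "m + (real k - m) * ?u = m * (1 - ?u) + k * ?u" by (simp add: algebra_simps)
      also have "\<dots> > 0" using t m_pos k_pos by (simp add: add_pos_pos)
      finally show ?thesis .
    qed
    have kap: "1 + \<kappa> = 1 / (1 - \<theta>)" using lam \<open>\<theta> < 1\<close> by (simp add: field_simps)
    have "(1 + \<kappa>) * ?u ^ m / P t / (m / ?u + k / (1 - ?u))
        = 1 / (c * ((m + (real k - m) * ?u) / (?u powr (1 + m * \<theta>) * (1 - ?u) powr (1 + k * (1 - \<theta>)))))"
    proof -
      have "?u powr (1 + m * \<theta>) = ?u * ?u powr (m * \<theta>)"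
          "(1 - ?u) powr (1 + k * (1 - \<theta>)) = (1 - ?u) * (1 - ?u) powr (k * (1 - \<theta>))"
        using t by (simp_all add: powr_add)
      then show ?thesis
        unfolding P w kap c_def using t pos \<open>\<theta> < 1\<close> by (simp add: mult_ac)
    qed
    then show ?thesis using F_derivative[OF t] by simp
  qed
  ultimately show ?thesis by blast
qed

end

section \<open>Quantile density\<close>

text \<open>The derivative of \<open>F\<close> is nonzero, so its inverse has derivative
  \<open>q\<close> by the inverse function rule; continuity of \<open>q\<close> then gives the
  integral form by the fundamental theorem.\<close>

lemma has_quantile_densityI:
  fixes F q :: "real \<Rightarrow> real" and a b :: ereal
  assumes mono: "\<And>x y. \<lbrakk>x \<in> einterval a b; y \<in> einterval a b; x < y\<rbrakk> \<Longrightarrow> F x < F y"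
    and surj: "F ` einterval a b = {0<..<1}"
    and der: "\<And>x. x \<in> einterval a b \<Longrightarrow> (F has_real_derivative 1 / q (F x)) (at x)"
    and q: "continuous_on {0<..<1} q" "\<And>u. u \<in> {0<..<1} \<Longrightarrow> q u \<noteq> 0"
  shows "has_quantile_density a b F q"
proof -
  define Q where "Q = quantile_fun a b F"
  have inj: "inj_on F (einterval a b)"
    by (rule linorder_inj_onI) (use mono in \<open>force+\<close>)
  have FQ: "F (Q u) = u" "Q u \<in> einterval a b" if "u \<in> {0<..<1}" for u
    using that inj surj unfolding Q_def quantile_fun_def
    by (auto intro: f_the_inv_into_f the_inv_into_into)
  have QF: "Q (F x) = x" if "x \<in> einterval a b" for x
    using that inj unfolding Q_def quantile_fun_def by (rule the_inv_into_f_f[rotated])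
  have contQ: "isCont Q u" if u: "u \<in> {0<..<1}" for u
  proof -
    \<comment> \<open>Continuity of the inverse at \<open>u\<close> requires a whole neighbourhood
      of \<open>Q u\<close> on which \<open>Q\<close> undoes \<open>F\<close>.\<close>
    have "open (einterval a b)" by simp
    then obtain d where d: "d > 0" "cball (Q u) d \<subseteq> einterval a b"
      using FQ(2)[OF u] by (meson open_contains_cball)
    then have ab: "z \<in> einterval a b" if "\<bar>z - Q u\<bar> \<le> d" for z
      using that by (auto simp: subset_iff dist_real_def abs_minus_commute)
    have "isCont Q (F (Q u))"
      by (rule isCont_inverse_function[OF d(1) QF[OF ab] DERIV_isCont[OF der[OF ab]]])
    then show ?thesis using FQ(1)[OF u] by simp
  qed
  have derQ: "(Q has_real_derivative q u) (at u)" if u: "u \<in> {0<..<1}" for u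
  proof -
    have "(F has_real_derivative 1 / q u) (at (Q u))"
      using der[OF FQ(2)[OF u]] FQ(1)[OF u] by simp
    then have "(Q has_real_derivative inverse (1 / q u)) (at u)"
      using u q(2)[OF u] contQ[OF u] FQ(1)
      by (intro DERIV_inverse_function[where f = F and a = 0 and b = 1]) auto
    then show ?thesis by simp
  qed
  have "interval_lebesgue_integrable lborel (ereal y0) (ereal y) q \<and> Q y - Q y0 = (LBINT u=ereal y0..ereal y. q u)"
    if y: "y0 \<in> {0<..<1}" "y \<in> {0<..<1}" for y0 y
  proof
    have sub: "{min y0 y..max y0 y} \<subseteq> {0<..<1}" using y by auto
    have c: "continuous_on {min y0 y..max y0 y} q" by (rule continuous_on_subset[OF q(1) sub])
    have "(LBINT u=y0..y. q u) = Q y - Q y0"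
    proof (rule interval_integral_FTC_finite[OF c])
      fix x assume "min y0 y \<le> x" "x \<le> max y0 y"
      then have "x \<in> {0<..<1}" using sub by auto
      then show "(Q has_vector_derivative q x) (at x within {min y0 y..max y0 y})"
        using derQ has_real_derivative_iff_has_vector_derivative has_vector_derivative_at_within by blast
    qed
    then show "Q y - Q y0 = (LBINT u=ereal y0..ereal y. q u)" by simp
    show "interval_lebesgue_integrable lborel (ereal y0) (ereal y) q"
    proof (cases "y0 \<le> y")
      case True
      then show ?thesis using c by (intro interval_integrable_continuous_on) (simp_all add: min_def max_def)
    next
      case False
      then have "interval_lebesgue_integrable lborel (ereal y) (ereal y0) q"
        using c by (intro interval_integrable_continuous_on) (simp_all add: min_def max_def)
      then show ?thesis using interval_integrable_endpoints_reverse by blast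
    qed
  qed
  then show ?thesis using derQ unfolding has_quantile_density_def Q_def by blast
qed

section \<open>The distribution function of a law with positive density on an interval\<close>

lemma cdf_of_positive_density:
  fixes X :: "'a \<Rightarrow> real" and f F :: "real \<Rightarrow> real" and a b :: ereal
  assumes "prob_space M" and X: "distributed M lborel X (\<lambda>x. ennreal (f x))"
    and "a < b" and AE: "AE \<omega> in M. X \<omega> \<in> einterval a b"
    and f: "\<And>x. x \<in> einterval a b \<Longrightarrow> f x > 0"
    and cdf_F: "cdf (distr M borel X) = F"
  shows "mono F" "continuous_on UNIV F" "0 \<le> F x" "F x \<le> 1" "(F \<longlongrightarrow> 0) at_bot"
    and "F x = measure M {\<omega> \<in> space M. X \<omega> \<le> x}"
    and "\<And>x y. \<lbrakk>x \<in> einterval a b; y \<in> einterval a b; x < y\<rbrakk> \<Longrightarrow> F x < F y"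
    and "{x. 0 < F x \<and> F x < 1} = einterval a b"
    and "F ` einterval a b = {0<..<1}"
proof -
  interpret prob_space M by fact
  have Xm [measurable]: "X \<in> borel_measurable M" using distributed_measurable[OF X] by simp
  have fm [measurable]: "(\<lambda>x. ennreal (f x)) \<in> borel_measurable lborel"
    by (rule distributed_borel_measurable[OF X])
  let ?D = "distr M borel X"
  note F_def = cdf_F[symmetric]
  interpret D: real_distribution ?D by (rule real_distribution_distr) simp
  have emD: "emeasure ?D B = (\<integral>\<^sup>+x. ennreal (f x) * indicator B x \<partial>lborel)" if "B \<in> sets borel" for B
  proof -
    have "emeasure ?D B = emeasure M (X -` B \<inter> space M)" using that by (simp add: emeasure_distr)
    also have "\<dots> = (\<integral>\<^sup>+x. ennreal (f x) * indicator B x \<partial>lborel)"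
      using distributed_emeasure[OF X, of B] that by simp
    finally show ?thesis .
  qed
  have F_eq: "F x = prob {\<omega> \<in> space M. X \<omega> \<le> x}" for x
    unfolding F_def cdf_def by (subst measure_distr) (auto intro!: arg_cong[where f = prob])
  then show "F x = measure M {\<omega> \<in> space M. X \<omega> \<le> x}" .
  have mono: "F x \<le> F y" if "x \<le> y" for x y unfolding F_def by (rule D.cdf_nondecreasing[OF that])
  then show "mono F" by (rule monoI)
  have nonneg: "0 \<le> F x" and le1: "F x \<le> 1" for x
    unfolding F_def by (rule D.cdf_nonneg, rule D.cdf_bounded_prob)
  then show "0 \<le> F x" "F x \<le> 1" .
  show bot: "(F \<longlongrightarrow> 0) at_bot" unfolding F_def by (rule D.cdf_lim_at_bot)
  have top: "(F \<longlongrightarrow> 1) at_top" unfolding F_def by (rule D.cdf_lim_at_top_prob)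
  have "isCont F x" for x
  proof -
    \<comment> \<open>A law with a density has no atoms, so its distribution function is
      continuous.\<close>
    have "emeasure ?D {x} = 0"
      by (subst emD) (auto intro!: nn_integral_0_iff_AE[THEN iffD2] AE_mp[OF AE_lborel_singleton[of x]])
    then show ?thesis unfolding F_def D.isCont_cdf by (simp add: measure_def)
  qed
  then show cont: "continuous_on UNIV F" by (simp add: continuous_on_eq_continuous_at)
  show less: "F x < F y" if xy: "x \<in> einterval a b" "y \<in> einterval a b" "x < y" for x y
  proof (rule ccontr)
    \<comment> \<open>Otherwise \<open>(x, y]\<close> carries no mass; as \<open>f\<close> is
      positive there, the interval would be a Lebesgue null set.\<close>
    assume "\<not> F x < F y"
    then have "measure ?D {x<..y} = 0"
      using mono[of x y] D.cdf_diff_eq[OF \<open>x < y\<close>] \<open>x < y\<close> by (simp add: F_def)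
    then have "(\<integral>\<^sup>+z. ennreal (f z) * indicator {x<..y} z \<partial>lborel) = 0"
      using emD[of "{x<..y}"] by (simp add: D.emeasure_eq_measure)
    then have "AE z in lborel. ennreal (f z) * indicator {x<..y} z = 0"
      by (subst (asm) nn_integral_0_iff_AE) auto
    moreover have "z \<in> einterval a b" if "z \<in> {x<..y}" for z
    proof -
      have "a < ereal x" "ereal x < ereal z" "ereal z \<le> ereal y" "ereal y < b"
        using that xy by (auto simp: einterval_def)
      then have "a < ereal z" "ereal z < b"
        using less_trans[of a "ereal x" "ereal z"] le_less_trans[of "ereal z" "ereal y" b] by blast+
      then show ?thesis unfolding einterval_def by simp
    qed
    ultimately have "AE z in lborel. z \<notin> {x<..y}"
      by (elim AE_mp) (use f in \<open>fastforce intro!: AE_I2 simp: indicator_def\<close>)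
    then have "emeasure lborel {x<..y} = 0"
      by (subst (asm) AE_iff_measurable[of "{x<..y}"]) auto
    then show False using \<open>x < y\<close> by simp
  qed
  \<comment> \<open>Points of the interval on either side of \<open>x\<close> turn strict
    monotonicity into \<open>0 < F x < 1\<close>.\<close>
  have in_open: "\<exists>z. z \<in> einterval a b \<and> z < x" "\<exists>z. z \<in> einterval a b \<and> x < z" if "x \<in> einterval a b" for x
  proof -
    have "a < ereal x" "ereal x < b" using that by (auto simp: einterval_def)
    then obtain z z' where "a < ereal z" "ereal z < ereal x" "ereal x < ereal z'" "ereal z' < b"
      using ereal_dense2 by metis
    moreover from this have "ereal z < b" "a < ereal z'" using that
      using less_trans[of "ereal z" "ereal x" b] less_trans[of a "ereal x" "ereal z'"]
      by (auto simp: einterval_def)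
    ultimately show "\<exists>z. z \<in> einterval a b \<and> z < x" "\<exists>z. z \<in> einterval a b \<and> x < z"
      by (auto simp: einterval_def)
  qed
  have outside: "F x = 0 \<or> F x = 1" if "x \<notin> einterval a b" for x
  proof -
    consider "ereal x \<le> a" | "b \<le> ereal x" using \<open>x \<notin> einterval a b\<close> by (auto simp: einterval_def not_less)
    then show ?thesis
    proof cases
      case 1
      have "AE \<omega> in M. \<not> X \<omega> \<le> x"
        using AE by eventually_elim (use 1 in \<open>auto simp: einterval_def dest: order.strict_trans1\<close>)
      then have "F x = 0" unfolding F_eq by (subst prob_eq_0) auto
      then show ?thesis ..
    next
      case 2
      have "AE \<omega> in M. X \<omega> \<le> x"
        using AE by eventually_elim (use 2 in \<open>auto simp: einterval_def dest: order.strict_trans2\<close>)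
      then have "F x = 1" unfolding F_eq by (subst prob_Collect_eq_1) auto
      then show ?thesis ..
    qed
  qed
  show supp: "{x. 0 < F x \<and> F x < 1} = einterval a b"
  proof (intro set_eqI iffI)
    fix x assume x: "x \<in> einterval a b"
    obtain z z' where z: "z \<in> einterval a b" "z < x" and z': "z' \<in> einterval a b" "x < z'"
      using in_open[OF x] by blast
    have "0 < F x" using less[OF z(1) x z(2)] nonneg[of z] by linarith
    moreover have "F x < 1" using less[OF x z'(1) z'(2)] le1[of z'] by linarith
    ultimately show "x \<in> {x. 0 < F x \<and> F x < 1}" by simp
  qed (use outside in force)
  show "F ` einterval a b = {0<..<1}"
  proof
    show "{0<..<1} \<subseteq> F ` einterval a b"
    proof
      fix u :: real assume u: "u \<in> {0<..<1}"
      have "\<forall>\<^sub>F x in at_bot. F x < u" "\<forall>\<^sub>F x in at_top. u < F x"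
        using order_tendstoD(2)[OF bot] order_tendstoD(1)[OF top] u by auto
      then obtain x y where "F x < u" "u < F y"
        by (auto simp: eventually_at_bot_linorder eventually_at_top_linorder)
      then have "x \<le> y" using mono[of y x] by linarith
      then obtain z where "F z = u"
        using IVT'[of F x u y] \<open>F x < u\<close> \<open>u < F y\<close> continuous_on_subset[OF cont] by auto
      then show "u \<in> F ` einterval a b" using u supp by auto
    qed
  qed (use supp in auto)
qed

section \<open>Specialization to order statistics and identification of the constants\<close>

theorem theorem3p4:
  fixes M :: "'a measure" and X :: "nat \<Rightarrow> 'a \<Rightarrow> real"
    and f F :: "real \<Rightarrow> real" and a b :: ereal and j n :: nat and lam :: real
  assumes "prob_space M"
    and "prob_space.indep_vars M (\<lambda>_. borel) X {1..}"
    and "\<And>i. i \<ge> 1 \<Longrightarrow> distributed M lborel (X i) (\<lambda>x. ennreal (f x))"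
    and "\<And>i. i \<ge> 1 \<Longrightarrow> cdf (distr M borel (X i)) = F"
    and "\<And>x. f x \<ge> 0"
    and "a < b"
    and "\<And>i. i \<ge> 1 \<Longrightarrow> AE \<omega> in M. X i \<omega> \<in> einterval a b"
    and "\<And>x. x \<in> einterval a b \<Longrightarrow> f x > 0"
    and "2 \<le> j" and "j \<le> n - 1"
    and "integrable M (order_stat X (j - 1) (n - 2))"
    and "AE \<omega> in M. cond_exp_given M (order_stat X (j - 1) (n - 2)) (order_stat X j n) \<omega>
                      = order_stat X j n \<omega>"
    and "lam = real j * (real j - 1)
                 / ((real n - real j + 1) * (real n - real j) + real j * (real j - 1))"
  shows "\<exists>q. has_quantile_density a b F q \<and>
           (\<exists>c>0. \<forall>u\<in>{0<..<1}.
              q u = c * ((real j - 1 + (real n - 2 * real j + 1) * u)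
                    / (u powr (1 + (real j - 1) * lam)
                       * (1 - u) powr (1 + (real n - real j) * (1 - lam)))))"
proof -
  interpret prob_space M by fact
  define m k N where "m = j - 1" and "k = n - j" and "N = n - 2"
  have mk: "0 < m" "0 < k" "m \<le> N" "j = Suc m" "n = Suc (Suc N)" "k = Suc N - m"
    using assms(9,10) by (auto simp: m_def k_def N_def)
  have rmk: "real j - 1 = m" "real n - real j = k" using mk by auto
  define Y Z where "Y = order_stat X m N" and "Z = order_stat X (Suc m) (Suc (Suc N))"
  have YZ: "order_stat X (j - 1) (n - 2) = Y" "order_stat X j n = Z"
    using mk by (simp_all add: Y_def Z_def)
  have X: "X i \<in> borel_measurable M" if "i \<ge> 1" for i
    using distributed_measurable[OF assms(3)[OF that]] by simp
  note cdf = cdf_of_positive_density[OF assms(1) assms(3)[OF order_refl] assms(6)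
      assms(7)[OF order_refl] assms(8) assms(4)[OF order_refl]]
  have F_eq: "measure M {\<omega> \<in> space M. X i \<omega> \<le> y} = F y" if "i \<in> {1..Suc (Suc N)}" for i y
    using cdf_of_positive_density(6)[OF assms(1) assms(3) assms(6-8) assms(4), of i y] that by simp
  have indep: "indep_vars (\<lambda>_. borel) X {1..Suc (Suc N)}"
    by (rule indep_vars_subset[OF assms(2)]) auto
  have Zm: "Z \<in> borel_measurable M"
    unfolding Z_def using X mk by (intro borel_measurable_order_stat) auto
  have Yi: "integrable M Y" using assms(11) YZ by simp
  have "AE \<omega> in M. cond_exp_given M Y Z \<omega> = Z \<omega>" using assms(12) YZ by simp
  note ce = cond_exp_given_eq_self[OF assms(1) Zm Yi this]
  let ?c1 = "real (N choose m)" and ?c2 = "real (N choose (m - 1))"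
  interpret balanced_cdf F m k ?c1 ?c2
  proof
    fix t
    have C: "{\<omega> \<in> space M. Z \<omega> \<le> t} \<in> events" using Zm by measurable
    let ?layer = "\<lambda>y. ?c2 * (F (min y t) ^ Suc m * (1 - F y) ^ k)
         - ?c1 * (F y ^ m * ((1 - F y) ^ Suc k - (1 - F (max y t)) ^ Suc k))"
    have layer: "(\<integral>\<omega>. ((if Z \<omega> \<le> y then 1 else 0) - (if Y \<omega> \<le> y then 1 else 0))
        * indicator {\<omega> \<in> space M. Z \<omega> \<le> t} \<omega> \<partial>M) = ?layer y" for y
      unfolding mk(6) Y_def Z_def by (rule expectation_layer[OF assms(1) indep F_eq mk(1,3)])
    show "integrable lborel ?layer" "integral\<^sup>L lborel ?layer = 0"
      using expectation_difference_eq_integral[OF assms(1) Yi ce(1) C] ce(2)[of t]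
      unfolding layer by simp_all
  next
    fix x y assume xy: "x < y" "0 < F x" "F y < 1"
    \<comment> \<open>Values strictly between 0 and 1 place both points in the interval, where
      \<open>F\<close> is strictly increasing.\<close>
    then have "0 < F y" "F x < 1" using monoD[OF cdf(1), of x y] by auto
    then show "F x < F y" using xy cdf(7,8) by blast
  qed (use cdf mk in auto)
  have kappa: "\<kappa> = real j * (real j - 1) / ((real n - real j + 1) * (real n - real j))"
  proof -
    have "N - (m - 1) = k" using mk by simp
    \<comment> \<open>Both sides equal \<open>N * (N - 1 choose (m - 1))\<close>; this is the ratio
      of \<open>?c1\<close> and \<open>?c2\<close> needed for \<open>\<kappa>\<close>.\<close>
    then have "m * (N choose m) = k * (N choose (m - 1))"
      using times_binomial_minus1_eq[OF mk(1), of N] binomial_absorb_comp[of N "m - 1"] by simp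
    then have "real m * ?c1 = real k * ?c2" by (metis of_nat_mult)
    then have c2: "?c2 = real m * ?c1 / real k" using mk(2) by (simp add: field_simps)
    have "?c1 \<noteq> 0" "real j = real m + 1" using mk by simp_all
    then have "?c2 * Suc m / (?c1 * Suc k) = real j * real m / ((real k + 1) * real k)"
      unfolding c2 using mk(2) by (simp add: mult_ac add_ac)
    then show ?thesis unfolding rmk \<kappa>_def .
  qed
  have fraction: "x / y / (1 + x / y) = x / (y + x)" if "0 \<le> x" "0 < y" for x y :: real
    using that by (simp add: field_simps)
  have theta: "\<theta> = lam"
    unfolding \<theta>_def kappa assms(13) rmk by (rule fraction) (use mk(2) in simp_all)
  \<comment> \<open>A real point of the possibly unbounded interval shows that \<open>F\<close>
    takes a value strictly between 0 and 1.\<close>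
  obtain r where "a < ereal r" "ereal r < b" using ereal_dense2[OF assms(6)] by blast
  then have "r \<in> einterval a b" by (simp add: einterval_def)
  then have "\<exists>t. 0 < F t \<and> F t < 1" using cdf(8) by blast
  then obtain c where c: "c > 0"
    and der: "\<And>t. \<lbrakk>0 < F t; F t < 1\<rbrakk> \<Longrightarrow> (F has_real_derivative 1 / (c * ((m + (real k - m) * F t)
        / (F t powr (1 + m * lam) * (1 - F t) powr (1 + k * (1 - lam)))))) (at t)"
    using F_derivative_eq[unfolded theta] by blast
  define q where "q u = c * ((real m + (real k - real m) * u)
      / (u powr (1 + real m * lam) * (1 - u) powr (1 + real k * (1 - lam))))" for u
  have "has_quantile_density a b F q"
  proof (rule has_quantile_densityI[OF cdf(7,9)])
    show "(F has_real_derivative 1 / q (F x)) (at x)" if "x \<in> einterval a b" for x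
      using der[of x] that cdf(8) unfolding q_def by blast
    show "continuous_on {0<..<1} q"
      unfolding q_def by (intro continuous_intros) auto
    show "q u \<noteq> 0" if "u \<in> {0<..<1}" for u
    proof -
      have "m + (real k - m) * u = m * (1 - u) + k * u" by (simp add: algebra_simps)
      also have "\<dots> > 0" using that mk by (simp add: add_pos_pos)
      finally show ?thesis using that c by (simp add: q_def)
    qed
  qed
  moreover have "q u = c * ((real j - 1 + (real n - 2 * real j + 1) * u)
                    / (u powr (1 + (real j - 1) * lam)
                       * (1 - u) powr (1 + (real n - real j) * (1 - lam))))" for u
  proof -
    have "real n - 2 * real j + 1 = real k - real m" using rmk by linarith
    then show ?thesis unfolding q_def rmk by simp
  qed
  ultimately show ?thesis using c by blast
qed

end
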